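(* Let $\Gamma=(\gamma_n)_{n\ge1}$ be a sequence of distinct complex numbers and $v=(v_n)$ a sequence of positive numbers such that $(\Gamma,v)^*\neq\emptyset$, and suppose that every exact uniqueness sequence for $H_{(\Gamma,v)}$ admits a generating function. Let $\Lambda=(\lambda_j)_{j\ge1}$ be a sequence of distinct points in $(\Gamma,v)^*$ and let $w$ be the Bessel weight sequence for $\Lambda$ with respect to $(\Gamma,v)$. Suppose $H_{(\Gamma,v);(\Lambda,w)}$ is bounded from $\ell^2_v$ to $\ell^2_w$. Then $H_{(\Gamma,v);(\Lambda,w)}$ is invertible (a bijection $\ell^2_v\to\ell^2_w$ with bounded inverse) if and only if $\Lambda$ is an exact uniqueness sequence for $H_{(\Gamma,v)}$ and the transformation $H_{(\Lambda,\varpi);(\Gamma,\nu)}$ is bounded from $\ell^2_\varpi$ to $\ell^2_\nu$ (in particular $\Gamma\subset(\Lambda,\varpi)^*$), where $\nu$ and $\varpi$ are defined as follows. Let $e=(e_n)\in\ell^2_v$ be the unique vector with $H_{(\Gamma,v)}e(\lambda_1)=1$ and $H_{(\Gamma,v)}e(\lambda_j)=0$ for $j\ge2$; set $\nu_n=v_n|\lambda_1-\gamma_n|^2|e_n|^2$, $\varpi_1=w_1^{-1}$ and, for $j\ge2$, \[ \varpi_j=w_j^{-1}|\lambda_j-\lambda_1|^{-2}\left|\sum_{n=1}^\infty\frac{e_nv_n}{(\lambda_j-\gamma_n)^2}\right|^{-2}. \]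
   Context: For a positive sequence $u$, $\ell^2_u=\{(a_k):\sum|a_k|^2u_k<\infty\}$. $(\Gamma,v)^*=\{z\in\mathbb{C}:\sum_n v_n/|z-\gamma_n|^2<\infty\}$, and for $a\in\ell^2_v$, $z\in(\Gamma,v)^*$, $H_{(\Gamma,v)}a(z)=\sum_na_nv_n/(z-\gamma_n)$. For a sequence $\Lambda=(\lambda_j)$ in $(\Gamma,v)^*$ and positive weights $w$, $H_{(\Gamma,v);(\Lambda,w)}a=(H_{(\Gamma,v)}a(\lambda_j))_j$; analogously, with roles exchanged, $H_{(\Lambda,\varpi);(\Gamma,\nu)}b=\left(\sum_j b_j\varpi_j/(\gamma_n-\lambda_j)\right)_n$ for $b\in\ell^2_\varpi$, which requires $\Gamma\subset(\Lambda,\varpi)^*=\{z:\sum_j\varpi_j/|z-\lambda_j|^2<\infty\}$. The Bessel weight sequence is $w_j=(\sum_n v_n/|\lambda_j-\gamma_n|^2)^{-1}$. A sequence $\Lambda$ of distinct points in $(\Gamma,v)^*$ is a uniqueness sequence for $H_{(\Gamma,v)}$ if no nonzero $a\in\ell^2_v$ has $H_{(\Gamma,v)}a$ vanishing on $\Lambda$; it is an exact uniqueness sequence if it is a uniqueness sequence but ceases to be one upon removal of any single point. For an exact uniqueness sequence $\Lambda$, a nontrivial function $G$ on $(\Gamma,v)^*$ is a generating function for $\Lambda$ if $G$ vanishes on $\Lambda$ and for every $\lambda_j\in\Lambda$ there is a nonzero $a^{(j)}\in\ell^2_v$ with $G(z)=(z-\lambda_j)H_{(\Gamma,v)}a^{(j)}(z)$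 for all $z\in(\Gamma,v)^*$. (When $\Lambda$ is an exact uniqueness sequence admitting a generating function, the vector $e$ exists uniquely and the series in $\varpi_j$ converges absolutely.) *)

theory Defs
  imports "HOL-Analysis.Analysis"
begin

(* Sequences are indexed by nat starting at 0: index 0 corresponds to index 1 of the paper. *)

definition l2w :: "(nat \<Rightarrow> real) \<Rightarrow> (nat \<Rightarrow> complex) set" where
  "l2w u = {a. summable (\<lambda>k. (cmod (a k))\<^sup>2 * u k)}"

definition l2norm :: "(nat \<Rightarrow> real) \<Rightarrow> (nat \<Rightarrow> complex) \<Rightarrow> real" where
  "l2norm u a = sqrt (\<Sum>k. (cmod (a k))\<^sup>2 * u k)"

text \<open>(Gamma,v)^*; points of Gamma are excluded explicitly (the paper's series is +infinity there).\<close>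
definition star_set :: "(nat \<Rightarrow> complex) \<Rightarrow> (nat \<Rightarrow> real) \<Rightarrow> complex set" where
  "star_set G v = {z. z \<notin> range G \<and> summable (\<lambda>n. v n / (cmod (z - G n))\<^sup>2)}"

definition Hfun :: "(nat \<Rightarrow> complex) \<Rightarrow> (nat \<Rightarrow> real) \<Rightarrow> (nat \<Rightarrow> complex) \<Rightarrow> complex \<Rightarrow> complex" where
  "Hfun G v a z = (\<Sum>n. a n * complex_of_real (v n) / (z - G n))"

definition Hmap :: "(nat \<Rightarrow> complex) \<Rightarrow> (nat \<Rightarrow> real) \<Rightarrow> (nat \<Rightarrow> complex)
    \<Rightarrow> (nat \<Rightarrow> complex) \<Rightarrow> (nat \<Rightarrow> complex)" where
  "Hmap G v L a = (\<lambda>j. Hfun G v a (L j))"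

definition bounded_op :: "(nat \<Rightarrow> real) \<Rightarrow> (nat \<Rightarrow> real)
    \<Rightarrow> ((nat \<Rightarrow> complex) \<Rightarrow> (nat \<Rightarrow> complex)) \<Rightarrow> bool" where
  "bounded_op u w T \<longleftrightarrow> (\<forall>a\<in>l2w u. T a \<in> l2w w) \<and>
     (\<exists>C. \<forall>a\<in>l2w u. l2norm w (T a) \<le> C * l2norm u a)"

definition invertible_op :: "(nat \<Rightarrow> real) \<Rightarrow> (nat \<Rightarrow> real)
    \<Rightarrow> ((nat \<Rightarrow> complex) \<Rightarrow> (nat \<Rightarrow> complex)) \<Rightarrow> bool" where
  "invertible_op u w T \<longleftrightarrow> bounded_op u w T \<and> bij_betw T (l2w u) (l2w w) \<and>
     bounded_op w u (the_inv_into (l2w u) T)"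

definition uniqueness_seq :: "(nat \<Rightarrow> complex) \<Rightarrow> (nat \<Rightarrow> real) \<Rightarrow> (nat \<Rightarrow> complex) \<Rightarrow> bool" where
  "uniqueness_seq G v L \<longleftrightarrow> inj L \<and> range L \<subseteq> star_set G v \<and>
     (\<forall>a\<in>l2w v. (\<forall>j. Hfun G v a (L j) = 0) \<longrightarrow> a = (\<lambda>_. 0))"

definition exact_uniqueness_seq :: "(nat \<Rightarrow> complex) \<Rightarrow> (nat \<Rightarrow> real) \<Rightarrow> (nat \<Rightarrow> complex) \<Rightarrow> bool" where
  "exact_uniqueness_seq G v L \<longleftrightarrow> uniqueness_seq G v L \<and>
     (\<forall>k. \<exists>a\<in>l2w v. a \<noteq> (\<lambda>_. 0) \<and> (\<forall>j. j \<noteq> k \<longrightarrow> Hfun G v a (L j) = 0))"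

definition generating_function :: "(nat \<Rightarrow> complex) \<Rightarrow> (nat \<Rightarrow> real) \<Rightarrow> (nat \<Rightarrow> complex)
    \<Rightarrow> (complex \<Rightarrow> complex) \<Rightarrow> bool" where
  "generating_function G v L F \<longleftrightarrow> (\<exists>z\<in>star_set G v. F z \<noteq> 0) \<and> (\<forall>j. F (L j) = 0) \<and>
     (\<forall>j. \<exists>a\<in>l2w v. a \<noteq> (\<lambda>_. 0) \<and> (\<forall>z\<in>star_set G v. F z = (z - L j) * Hfun G v a z))"

definition bessel_weight :: "(nat \<Rightarrow> complex) \<Rightarrow> (nat \<Rightarrow> real) \<Rightarrow> (nat \<Rightarrow> complex) \<Rightarrow> nat \<Rightarrow> real" where
  "bessel_weight G v L j = inverse (\<Sum>n. v n / (cmod (L j - G n))\<^sup>2)"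

definition evec :: "(nat \<Rightarrow> complex) \<Rightarrow> (nat \<Rightarrow> real) \<Rightarrow> (nat \<Rightarrow> complex) \<Rightarrow> nat \<Rightarrow> complex" where
  "evec G v L = (THE e. e \<in> l2w v \<and> Hfun G v e (L 0) = 1 \<and> (\<forall>j. j \<noteq> 0 \<longrightarrow> Hfun G v e (L j) = 0))"

definition nu_weight :: "(nat \<Rightarrow> complex) \<Rightarrow> (nat \<Rightarrow> real) \<Rightarrow> (nat \<Rightarrow> complex) \<Rightarrow> nat \<Rightarrow> real" where
  "nu_weight G v L n = v n * (cmod (L 0 - G n))\<^sup>2 * (cmod (evec G v L n))\<^sup>2"

definition varpi_weight :: "(nat \<Rightarrow> complex) \<Rightarrow> (nat \<Rightarrow> real) \<Rightarrow> (nat \<Rightarrow> complex) \<Rightarrow> nat \<Rightarrow> real" where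
  "varpi_weight G v L j =
     (if j = 0 then inverse (bessel_weight G v L 0)
      else inverse (bessel_weight G v L j) * inverse ((cmod (L j - L 0))\<^sup>2) *
           inverse ((cmod (\<Sum>n. evec G v L n * complex_of_real (v n) / (L j - G n)\<^sup>2))\<^sup>2))"

end

theory Submission
  imports Defs
begin

text \<open>Let \<open>d j\<close> be the vectors dual to the points \<open>\<lambda>\<^sub>j\<close>, so \<open>e = d 0\<close>. Everything rests on the
  proportionality \<open>e\<^sub>n (\<gamma>\<^sub>n - \<lambda>\<^sub>0) = c\<^sub>j d\<^sub>j\<^sub>n (\<gamma>\<^sub>n - \<lambda>\<^sub>j)\<close>, which makes the inverse of one Cauchy type matrix
  a rescaled Cauchy type matrix and identifies \<open>\<varpi>\<^sub>j\<close> with \<open>1 / (w\<^sub>j \<bar>c\<^sub>j\<bar>\<^sup>2)\<close>. It holds for every exact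
  uniqueness sequence. Indeed, for a point \<open>z\<close> the sequence \<open>d\<^sub>j\<^sub>n (\<gamma>\<^sub>n - \<lambda>\<^sub>j) / (\<gamma>\<^sub>n - z)\<close> is mapped to
  a multiple of \<open>1 / (\<lambda>\<^sub>i - z)\<close>, so a suitable combination of two of them is annihilated by all
  the kernels \<open>1 / (\<lambda>\<^sub>i - \<gamma>\<^sub>n)\<close>. The combination may fail to be in \<open>\<ell>\<^sup>2\<^sub>v\<close> when the \<open>\<gamma>\<^sub>n\<close> accumulate everywhere,
  but for almost every \<open>z\<close> it still pairs continuously with fast approximations of the unit vectors by
  kernels, and hence vanishes.\<close>

section \<open>Weighted square-summable sequences\<close>

text \<open>Finite sections of the norm, written through \<open>L2_set\<close> so that the Minkowski
  and Cauchy-Schwarz inequalities for finite sums carry over to \<open>l2w\<close>.\<close>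

definition psum :: "(nat \<Rightarrow> real) \<Rightarrow> (nat \<Rightarrow> complex) \<Rightarrow> nat \<Rightarrow> real" where
  "psum u a n = L2_set (\<lambda>k. cmod (a k) * sqrt (u k)) {..<n}"

lemma psum_eq:
  assumes "\<forall>k. 0 \<le> u k"
  shows "psum u a n = sqrt (\<Sum>k<n. (cmod (a k))\<^sup>2 * u k)"
  using assms by (simp add: psum_def L2_set_def power_mult_distrib)

lemma psum_nonneg [simp]: "0 \<le> psum u a n"
  by (simp add: psum_def)

lemma psum_le_l2norm:
  assumes "\<forall>k. 0 \<le> u k" "a \<in> l2w u"
  shows "psum u a n \<le> l2norm u a"
  using assms unfolding psum_eq[OF assms(1)] l2norm_def l2w_def
  by (auto intro!: sum_le_suminf)

text \<open>Turns a uniform bound on finite sections into membership and a norm bound at once. The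
  triangle inequality and completeness both pass through it, so that limits are only ever taken in
  finite sums.\<close>

lemma l2w_psumI:
  assumes u: "\<forall>k. 0 \<le> u k" and le: "\<And>n. psum u a n \<le> C"
  shows "a \<in> l2w u" "l2norm u a \<le> C"
proof -
  have C: "0 \<le> C" using le[of 0] psum_nonneg[of u a 0] by linarith
  have b: "(\<Sum>k<n. (cmod (a k))\<^sup>2 * u k) \<le> C\<^sup>2" for n
    using le[of n] C unfolding psum_eq[OF u]
    by (metis real_sqrt_le_iff real_sqrt_pow2_iff real_sqrt_abs abs_of_nonneg)
  have s: "summable (\<lambda>k. (cmod (a k))\<^sup>2 * u k)"
    by (rule summableI_nonneg_bounded[OF _ b]) (use u in auto)
  then show "a \<in> l2w u" by (simp add: l2w_def)
  have "(\<Sum>k. (cmod (a k))\<^sup>2 * u k) \<le> C\<^sup>2"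
    by (rule suminf_le_const[OF s b])
  then show "l2norm u a \<le> C"
    unfolding l2norm_def using C by (simp add: real_le_lsqrt)
qed

lemma psum_add:
  assumes "\<forall>k. 0 \<le> u k"
  shows "psum u (\<lambda>k. a k + b k) n \<le> psum u a n + psum u b n"
proof -
  have "psum u (\<lambda>k. a k + b k) n
      \<le> L2_set (\<lambda>k. cmod (a k) * sqrt (u k) + cmod (b k) * sqrt (u k)) {..<n}"
    unfolding psum_def using assms
    by (intro L2_set_mono) (auto simp: distrib_right[symmetric] norm_triangle_ineq intro!: mult_right_mono)
  also have "\<dots> \<le> psum u a n + psum u b n"
    unfolding psum_def by (rule L2_set_triangle_ineq)
  finally show ?thesis .
qed

lemma l2w_add:
  assumes "\<forall>k. 0 \<le> u k" "a \<in> l2w u" "b \<in> l2w u"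
  shows "(\<lambda>k. a k + b k) \<in> l2w u" "l2norm u (\<lambda>k. a k + b k) \<le> l2norm u a + l2norm u b"
proof -
  have "psum u (\<lambda>k. a k + b k) n \<le> l2norm u a + l2norm u b" for n
    using psum_add[OF assms(1), of a b n] psum_le_l2norm[OF assms(1,2), of n] psum_le_l2norm[OF assms(1,3), of n]
    by linarith
  then show "(\<lambda>k. a k + b k) \<in> l2w u" "l2norm u (\<lambda>k. a k + b k) \<le> l2norm u a + l2norm u b"
    using l2w_psumI[OF assms(1)] by blast+
qed

lemma l2w_scale:
  assumes "a \<in> l2w u"
  shows "(\<lambda>k. c * a k) \<in> l2w u" "l2norm u (\<lambda>k. c * a k) = cmod c * l2norm u a"
proof -
  have eq: "(cmod (c * a k))\<^sup>2 * u k = (cmod c)\<^sup>2 * ((cmod (a k))\<^sup>2 * u k)" for k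
    by (simp add: norm_mult power_mult_distrib)
  show "(\<lambda>k. c * a k) \<in> l2w u"
    using assms by (simp only: l2w_def mem_Collect_eq eq summable_mult)
  show "l2norm u (\<lambda>k. c * a k) = cmod c * l2norm u a"
    using assms unfolding l2norm_def eq l2w_def
    by (simp add: suminf_mult real_sqrt_mult)
qed

lemma l2w_diff:
  assumes "\<forall>k. 0 \<le> u k" "a \<in> l2w u" "b \<in> l2w u"
  shows "(\<lambda>k. a k - b k) \<in> l2w u"
  using l2w_add(1)[OF assms(1,2) l2w_scale(1)[OF assms(3), of "-1"]] by simp

lemma l2w_sum:
  assumes "\<forall>k. 0 \<le> u k" "finite I" "\<And>i. i \<in> I \<Longrightarrow> f i \<in> l2w u"
  shows "(\<lambda>k. \<Sum>i\<in>I. f i k) \<in> l2w u"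
  using assms(2,3)
proof (induction I rule: finite_induct)
  case empty
  then show ?case by (simp add: l2w_def)
next
  case (insert i I)
  then show ?case using l2w_add(1)[OF assms(1), of "f i" "\<lambda>k. \<Sum>i\<in>I. f i k"] by simp
qed

lemma l2norm_nonneg:
  assumes "\<forall>k. 0 \<le> u k" "a \<in> l2w u"
  shows "0 \<le> l2norm u a"
  using psum_le_l2norm[OF assms, of 0] psum_nonneg[of u a 0] by linarith

lemma finite_support_in_l2w: "(\<And>k. k \<ge> N \<Longrightarrow> a k = 0) \<Longrightarrow> a \<in> l2w u"
  unfolding l2w_def by (auto intro!: summable_finite[of "{..<N}"]) (meson not_less)

lemma l2w_coord:
  assumes "\<forall>k. 0 \<le> u k" "a \<in> l2w u"
  shows "cmod (a n) * sqrt (u n) \<le> l2norm u a"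
proof -
  have "cmod (a n) * sqrt (u n) \<le> psum u a (Suc n)"
    unfolding psum_def by (rule member_le_L2_set) auto
  then show ?thesis using psum_le_l2norm[OF assms, of "Suc n"] by linarith
qed

lemma Cauchy_Schwarz_l2w:
  assumes u: "\<forall>k. 0 \<le> u k" and a: "a \<in> l2w u" and b: "b \<in> l2w u"
  shows "summable (\<lambda>k. cmod (a k) * cmod (b k) * u k)"
    "(\<Sum>k. cmod (a k) * cmod (b k) * u k) \<le> l2norm u a * l2norm u b"
proof -
  have bound: "(\<Sum>k<n. cmod (a k) * cmod (b k) * u k) \<le> l2norm u a * l2norm u b" for n
  proof -
    have "(\<Sum>k<n. cmod (a k) * cmod (b k) * u k)
        = (\<Sum>k<n. \<bar>cmod (a k) * sqrt (u k)\<bar> * \<bar>cmod (b k) * sqrt (u k)\<bar>)"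
      using u by (intro sum.cong) (auto simp: abs_mult algebra_simps)
    also have "\<dots> \<le> psum u a n * psum u b n"
      unfolding psum_def by (rule L2_set_mult_ineq)
    also have "\<dots> \<le> l2norm u a * l2norm u b"
      using psum_le_l2norm[OF u a] psum_le_l2norm[OF u b] l2norm_nonneg[OF u a]
      by (intro mult_mono) auto
    finally show ?thesis .
  qed
  show s: "summable (\<lambda>k. cmod (a k) * cmod (b k) * u k)"
    by (rule summableI_nonneg_bounded[OF _ bound]) (use u in auto)
  show "(\<Sum>k. cmod (a k) * cmod (b k) * u k) \<le> l2norm u a * l2norm u b"
    by (rule suminf_le_const[OF s bound])
qed

definition truncate_seq :: "nat \<Rightarrow> (nat \<Rightarrow> complex) \<Rightarrow> nat \<Rightarrow> complex" where
  "truncate_seq N a = (\<lambda>k. if k < N then a k else 0)"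

lemma truncate_seq_l2w [simp]: "truncate_seq N a \<in> l2w u"
  by (rule finite_support_in_l2w[of N]) (simp add: truncate_seq_def)

lemma truncate_seq_tendsto:
  assumes u: "\<forall>k. 0 \<le> u k" and a: "a \<in> l2w u"
  shows "(\<lambda>N. l2norm u (\<lambda>k. a k - truncate_seq N a k)) \<longlonglongrightarrow> 0"
proof -
  let ?f = "\<lambda>k. (cmod (a k))\<^sup>2 * u k"
  have s: "summable ?f" using a by (simp add: l2w_def)
  have "(\<Sum>k. (cmod (a k - truncate_seq N a k))\<^sup>2 * u k) = (\<Sum>k. ?f (k + N))" for N
  proof -
    let ?g = "\<lambda>k. (cmod (a k - truncate_seq N a k))\<^sup>2 * u k"
    have "(\<lambda>k. a k - truncate_seq N a k) \<in> l2w u" by (intro l2w_diff u a) simp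
    then have "summable ?g" by (simp add: l2w_def)
    from suminf_split_initial_segment[OF this, of N]
    have "suminf ?g = (\<Sum>k. ?g (k + N)) + (\<Sum>k<N. ?g k)" .
    also have "(\<Sum>k<N. ?g k) = 0" by (auto simp: truncate_seq_def)
    also have "(\<Sum>k. ?g (k + N)) = (\<Sum>k. ?f (k + N))" by (simp add: truncate_seq_def)
    finally show ?thesis by simp
  qed
  then show ?thesis
    unfolding l2norm_def
    using tendsto_real_sqrt[OF suminf_exist_split2[OF s]] by simp
qed

definition unit_seq :: "nat \<Rightarrow> nat \<Rightarrow> complex" where
  "unit_seq n = (\<lambda>m. if m = n then 1 else 0)"

lemma unit_seq_l2w [simp]: "unit_seq n \<in> l2w u"
  by (rule finite_support_in_l2w[of "Suc n"]) (simp add: unit_seq_def)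

section \<open>Hilbert space geometry: completeness, parallelogram law and density\<close>

lemma l2norm_minus_commute: "l2norm u (\<lambda>k. a k - b k) = l2norm u (\<lambda>k. b k - a k)"
  by (simp add: l2norm_def norm_minus_commute)

lemma l2norm_triangle_diff:
  assumes "\<forall>k. 0 \<le> u k" "a \<in> l2w u" "b \<in> l2w u" "c \<in> l2w u"
  shows "l2norm u (\<lambda>k. a k - c k) \<le> l2norm u (\<lambda>k. a k - b k) + l2norm u (\<lambda>k. b k - c k)"
  using l2w_add(2)[OF assms(1) l2w_diff[OF assms(1,2,3)] l2w_diff[OF assms(1,3,4)]] by simp

lemma l2norm_square:
  assumes "\<forall>k. 0 \<le> u k" "a \<in> l2w u"
  shows "(l2norm u a)\<^sup>2 = (\<Sum>k. (cmod (a k))\<^sup>2 * u k)"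
  using assms unfolding l2norm_def l2w_def
  by (simp add: suminf_nonneg)

text \<open>The weights are strictly positive, so a Cauchy sequence converges in each coordinate.
  Letting \<open>l\<close> grow in finite sections with \<open>k\<close> fixed shows that the limit
  inherits the explicit rate \<open>\<epsilon>\<close>.\<close>

lemma l2w_complete:
  assumes u: "\<forall>k. 0 < u k" and s: "\<And>k. s k \<in> l2w u"
    and cauchy: "\<And>k l. k \<le> l \<Longrightarrow> l2norm u (\<lambda>n. s k n - s l n) \<le> \<epsilon> k"
    and \<epsilon>: "\<epsilon> \<longlonglongrightarrow> 0"
  shows "\<exists>t\<in>l2w u. \<forall>k. l2norm u (\<lambda>n. s k n - t n) \<le> \<epsilon> k"
proof -
  have u0: "\<forall>k. 0 \<le> u k" using u by (simp add: less_imp_le)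
  have coord: "cmod (s k n - s l n) * sqrt (u n) \<le> \<epsilon> k" if "k \<le> l" for k l n
    using l2w_coord[OF u0 l2w_diff[OF u0 s s], of k n l] cauchy[OF that] by linarith
  have "Cauchy (\<lambda>k. s k n)" for n
  proof (rule metric_CauchyI)
    fix e :: real assume e: "0 < e"
    have un: "0 < sqrt (u n)" using u by simp
    with e have "eventually (\<lambda>k. \<epsilon> k < e / 2 * sqrt (u n)) sequentially"
      by (intro order_tendstoD(2)[OF \<epsilon>]) auto
    then obtain N where N: "\<epsilon> N < e / 2 * sqrt (u n)"
      by (auto simp: eventually_sequentially)
    have "cmod (s N n - s l n) < e / 2" if "N \<le> l" for l
      using coord[OF that, of n] N un by (meson le_less_trans mult_less_cancel_right_pos)
    then have "dist (s k n) (s l n) < e" if "N \<le> k" "N \<le> l" for k l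
      using that by (metis dist_norm dist_commute dist_triangle_half_l norm_minus_commute)
    then show "\<exists>M. \<forall>m\<ge>M. \<forall>l\<ge>M. dist (s m n) (s l n) < e" by blast
  qed
  then have "\<forall>n. \<exists>x. (\<lambda>k. s k n) \<longlonglongrightarrow> x"
    using Cauchy_convergent by (auto simp: convergent_def)
  then obtain t where t: "\<And>n. (\<lambda>k. s k n) \<longlonglongrightarrow> t n" by metis
  have le: "psum u (\<lambda>n. s k n - t n) N \<le> \<epsilon> k" for k N
  proof (rule tendsto_upperbound)
    show "(\<lambda>l. psum u (\<lambda>n. s k n - s l n) N) \<longlonglongrightarrow> psum u (\<lambda>n. s k n - t n) N"
      unfolding psum_def L2_set_def by (intro tendsto_intros t)
    show "\<forall>\<^sub>F l in sequentially. psum u (\<lambda>n. s k n - s l n) N \<le> \<epsilon> k"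
      using eventually_ge_at_top[of k]
      by eventually_elim (rule order_trans[OF psum_le_l2norm[OF u0 l2w_diff[OF u0 s s]] cauchy])
  qed simp
  have "(\<lambda>n. s 0 n - t n) \<in> l2w u" using l2w_psumI(1)[OF u0 le] .
  from l2w_diff[OF u0 s[of 0] this] have "t \<in> l2w u" by simp
  then show ?thesis using l2w_psumI(2)[OF u0 le] by blast
qed

text \<open>Expansion along a real direction, where the conjugate turns the bilinear pairing into
  the inner product. The values 1 and -1 of \<open>c\<close> yield the parallelogram law, and
  arbitrary real \<open>c\<close> the first variation at a point of minimal distance.\<close>

lemma l2norm_square_diff_scale:
  assumes u: "\<forall>k. 0 \<le> u k" and a: "a \<in> l2w u" and b: "b \<in> l2w u"
  shows "(l2norm u (\<lambda>k. a k - of_real c * b k))\<^sup>2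
    = (l2norm u a)\<^sup>2 - 2 * c * Re (\<Sum>k. cnj (a k) * b k * of_real (u k)) + c\<^sup>2 * (l2norm u b)\<^sup>2"
proof -
  have sp: "summable (\<lambda>k. cnj (a k) * b k * of_real (u k))"
    using Cauchy_Schwarz_l2w(1)[OF u a b] u
    by (intro summable_norm_cancel[where f="\<lambda>k. cnj (a k) * b k * of_real (u k)"]) (simp add: norm_mult)
  have sa: "summable (\<lambda>k. (cmod (a k))\<^sup>2 * u k)" and sb: "summable (\<lambda>k. (cmod (b k))\<^sup>2 * u k)"
    using a b by (auto simp: l2w_def)
  have "(cmod (a k - of_real c * b k))\<^sup>2 * u k
     = (cmod (a k))\<^sup>2 * u k - 2 * c * Re (cnj (a k) * b k * of_real (u k)) + c\<^sup>2 * ((cmod (b k))\<^sup>2 * u k)" for k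
    by (simp add: cmod_power2) (simp add: power2_eq_square algebra_simps)
  moreover have "(\<lambda>k. (cmod (a k))\<^sup>2 * u k - 2 * c * Re (cnj (a k) * b k * of_real (u k)) + c\<^sup>2 * ((cmod (b k))\<^sup>2 * u k))
    sums ((l2norm u a)\<^sup>2 - 2 * c * Re (\<Sum>k. cnj (a k) * b k * of_real (u k)) + c\<^sup>2 * (l2norm u b)\<^sup>2)"
    unfolding l2norm_square[OF u a] l2norm_square[OF u b]
    by (intro sums_add sums_diff sums_mult summable_sums sa sb sums_Re sp)
  moreover have "(\<lambda>k. a k - of_real c * b k) \<in> l2w u"
    by (intro l2w_diff l2w_scale u a b)
  ultimately show ?thesis
    using l2norm_square[OF u] by (simp add: sums_iff)
qed

lemma parallelogram_l2w:
  assumes u: "\<forall>k. 0 \<le> u k" and a: "a \<in> l2w u" and b: "b \<in> l2w u"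
  shows "(l2norm u (\<lambda>k. a k - b k))\<^sup>2
    = 2 * (l2norm u a)\<^sup>2 + 2 * (l2norm u b)\<^sup>2 - 4 * (l2norm u (\<lambda>k. (a k + b k) / 2))\<^sup>2"
proof -
  have "(l2norm u (\<lambda>k. a k + b k))\<^sup>2 = 4 * (l2norm u (\<lambda>k. (a k + b k) / 2))\<^sup>2"
  proof -
    have "l2norm u (\<lambda>k. a k + b k) = 2 * l2norm u (\<lambda>k. (a k + b k) / 2)"
      using l2w_scale(2)[OF l2w_add(1)[OF u a b], of "1 / 2"] by simp
    then show ?thesis by (simp add: power2_eq_square)
  qed
  then show ?thesis
    using l2norm_square_diff_scale[OF u a b, of 1] l2norm_square_diff_scale[OF u a b, of "-1"] by simp
qed

text \<open>First-order condition for a quadratic polynomial that is minimal at 0.\<close>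

lemma quadratic_nonneg_imp_linear_zero:
  fixes P B :: real
  assumes "\<And>x. 0 \<le> x\<^sup>2 * B - 2 * x * P" "0 \<le> B"
  shows "P = 0"
proof -
  \<comment> \<open>The vertex would be \<open>P / B\<close>. The shifted denominator covers
    \<open>B = 0\<close> and still makes the polynomial equal to
    \<open>- (x^2 * (B + 2))\<close>.\<close>
  define x where "x = P / (B + 1)"
  have P: "P = x * (B + 1)" using assms(2) by (simp add: x_def)
  have "0 \<le> - (x\<^sup>2 * (B + 2))"
    using assms(1)[of x] by (simp add: P power2_eq_square algebra_simps)
  then have "x = 0" using assms(2) by (simp add: mult_le_0_iff)
  then show ?thesis by (simp add: P)
qed

text \<open>The pairing is bilinear, so the orthogonality argument is applied to the conjugate of the
  residual.\<close>

lemma dense_if_annihilator_trivial: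
  assumes u: "\<forall>k. 0 < u k" and S: "S \<subseteq> l2w u" "S \<noteq> {}"
    and add: "\<And>a b. a \<in> S \<Longrightarrow> b \<in> S \<Longrightarrow> (\<lambda>k. a k + b k) \<in> S"
    and scale: "\<And>a c. a \<in> S \<Longrightarrow> (\<lambda>k. c * a k) \<in> S"
    and ann: "\<And>a. a \<in> l2w u \<Longrightarrow> (\<And>s. s \<in> S \<Longrightarrow> (\<Sum>k. a k * s k * of_real (u k)) = 0) \<Longrightarrow> a = (\<lambda>_. 0)"
    and t: "t \<in> l2w u" and e: "0 < e"
  shows "\<exists>s\<in>S. l2norm u (\<lambda>k. t k - s k) < e"
proof -
  have u0: "\<forall>k. 0 \<le> u k" using u by (simp add: less_imp_le)
  have Sl: "s \<in> l2w u" if "s \<in> S" for s using S that by auto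
  define D where "D = (\<lambda>s. (l2norm u (\<lambda>k. t k - s k))\<^sup>2) ` S"
  define d where "d = Inf D"
  have bd: "bdd_below D" unfolding D_def by (rule bdd_belowI[of _ 0]) auto
  have dle: "d \<le> (l2norm u (\<lambda>k. t k - s k))\<^sup>2" if "s \<in> S" for s
    unfolding d_def by (rule cInf_lower[OF _ bd]) (use that in \<open>auto simp: D_def\<close>)
  have d0: "0 \<le> d" unfolding d_def by (rule cInf_greatest) (use S in \<open>auto simp: D_def\<close>)
  have "\<exists>s\<in>S. (l2norm u (\<lambda>k. t k - s k))\<^sup>2 < d + inverse (real (Suc k))" for k
  proof -
    have "Inf D < d + inverse (real (Suc k))" by (simp add: d_def)
    then have "\<exists>x\<in>D. x < d + inverse (real (Suc k))"
      using S by (subst (asm) cInf_less_iff[OF _ bd]) (auto simp: D_def)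
    then show ?thesis by (auto simp: D_def)
  qed
  then obtain s where sS: "\<And>k. s k \<in> S"
    and sd: "\<And>k. (l2norm u (\<lambda>n. t n - s k n))\<^sup>2 < d + inverse (real (Suc k))" by metis
  \<comment> \<open>The rate comes from the parallelogram law: the midpoint of \<open>s k\<close>
    and \<open>s l\<close> lies in \<open>S\<close>, so the squared distance is at most
    \<open>2 (d + 1/(k+1)) + 2 (d + 1/(l+1)) - 4 d\<close>.\<close>
  define \<epsilon> where "\<epsilon> k = sqrt (4 * inverse (real (Suc k)))" for k
  have \<epsilon>: "\<epsilon> \<longlonglongrightarrow> 0"
    unfolding \<epsilon>_def using tendsto_real_sqrt[OF tendsto_mult_right_zero[OF LIMSEQ_inverse_real_of_nat, of 4]]
    by simp
  have cauchy: "l2norm u (\<lambda>n. s k n - s l n) \<le> \<epsilon> k" if "k \<le> l" for k l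
  proof -
    have "(\<lambda>n. 1/2 * (s l n + s k n)) \<in> S" by (intro scale add sS)
    from dle[OF this] have "d \<le> (l2norm u (\<lambda>n. ((t n - s l n) + (t n - s k n)) / 2))\<^sup>2"
      by (simp add: field_simps)
    moreover have "(l2norm u (\<lambda>n. s k n - s l n))\<^sup>2
       = 2 * (l2norm u (\<lambda>n. t n - s l n))\<^sup>2 + 2 * (l2norm u (\<lambda>n. t n - s k n))\<^sup>2
         - 4 * (l2norm u (\<lambda>n. ((t n - s l n) + (t n - s k n)) / 2))\<^sup>2"
      using parallelogram_l2w[OF u0 l2w_diff[OF u0 t Sl[OF sS[of l]]] l2w_diff[OF u0 t Sl[OF sS[of k]]]]
      by simp
    moreover have "inverse (real (Suc l)) \<le> inverse (real (Suc k))"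
      using that by (intro le_imp_inverse_le) auto
    ultimately have "(l2norm u (\<lambda>n. s k n - s l n))\<^sup>2 \<le> 4 * inverse (real (Suc k))"
      using sd[of k] sd[of l] by linarith
    then show ?thesis unfolding \<epsilon>_def by (rule real_le_rsqrt)
  qed
  obtain s' where s': "s' \<in> l2w u" and lim: "\<And>k. l2norm u (\<lambda>n. s k n - s' n) \<le> \<epsilon> k"
    using l2w_complete[OF u Sl[OF sS] cauchy \<epsilon>] by auto
  define r where "r = (\<lambda>n. t n - s' n)"
  have r: "r \<in> l2w u" unfolding r_def by (rule l2w_diff[OF u0 t s'])
  have "l2norm u r \<le> sqrt d"
  proof (rule tendsto_lowerbound)
    show "(\<lambda>k. sqrt (d + inverse (real (Suc k))) + \<epsilon> k) \<longlonglongrightarrow> sqrt d"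
      using tendsto_add[OF tendsto_real_sqrt[OF LIMSEQ_inverse_real_of_nat_add] \<epsilon>] by simp
    show "\<forall>\<^sub>F k in sequentially. l2norm u r \<le> sqrt (d + inverse (real (Suc k))) + \<epsilon> k"
    proof (intro always_eventually allI)
      fix k
      have "l2norm u (\<lambda>n. t n - s k n) \<le> sqrt (d + inverse (real (Suc k)))"
        using sd[of k] by (intro real_le_rsqrt) simp
      then show "l2norm u r \<le> sqrt (d + inverse (real (Suc k))) + \<epsilon> k"
        using l2norm_triangle_diff[OF u0 t Sl[OF sS[of k]] s'] lim[of k] unfolding r_def by linarith
    qed
  qed simp
  then have rd: "(l2norm u r)\<^sup>2 \<le> d"
    using l2norm_nonneg[OF u0 r] d0 by (metis power_mono real_sqrt_pow2)
  \<comment> \<open>The limit \<open>s'\<close> need not belong to \<open>S\<close>, so minimality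
    is applied to \<open>s k + q\<close>, which does, and the error \<open>\<epsilon> k\<close> is
    then sent to 0.\<close>
  have ge: "d \<le> (l2norm u (\<lambda>n. r n - q n))\<^sup>2" if q: "q \<in> S" for q
  proof -
    have rq: "(\<lambda>n. r n - q n) \<in> l2w u" by (intro l2w_diff[OF u0] r Sl q)
    have "sqrt d \<le> l2norm u (\<lambda>n. r n - q n) + \<epsilon> k" for k
    proof -
      have m: "(\<lambda>n. s k n + q n) \<in> S" by (intro add sS q)
      have "sqrt d \<le> l2norm u (\<lambda>n. t n - (s k n + q n))"
        using dle[OF m] l2norm_nonneg[OF u0 l2w_diff[OF u0 t Sl[OF m]]] by (simp add: real_le_lsqrt)
      also have "\<dots> \<le> l2norm u (\<lambda>n. t n - (s' n + q n)) + l2norm u (\<lambda>n. (s' n + q n) - (s k n + q n))"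
        by (intro l2norm_triangle_diff u0 t l2w_add s' Sl q m)
      also have "l2norm u (\<lambda>n. (s' n + q n) - (s k n + q n)) = l2norm u (\<lambda>n. s k n - s' n)"
        using l2norm_minus_commute[of u s' "s k"] by simp
      finally show ?thesis using lim[of k] by (simp add: r_def algebra_simps)
    qed
    then have "sqrt d \<le> l2norm u (\<lambda>n. r n - q n)"
      by (intro tendsto_lowerbound[OF tendsto_add[OF tendsto_const \<epsilon>, where a="l2norm u (\<lambda>n. r n - q n)", simplified]])
         (auto)
    then show ?thesis using l2norm_nonneg[OF u0 rq] d0
      by (metis power_mono real_sqrt_ge_zero real_sqrt_pow2)
  qed
  have Re0: "Re (\<Sum>k. cnj (r k) * q k * of_real (u k)) = 0" if q: "q \<in> S" for q
  proof (rule quadratic_nonneg_imp_linear_zero[where B="(l2norm u q)\<^sup>2"])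
    fix x :: real
    show "0 \<le> x\<^sup>2 * (l2norm u q)\<^sup>2 - 2 * x * Re (\<Sum>k. cnj (r k) * q k * of_real (u k))"
      using ge[OF scale[OF q, of "of_real x"]] rd l2norm_square_diff_scale[OF u0 r Sl[OF q], of x] by linarith
  qed simp
  \<comment> \<open>Only real parts have been shown to vanish; testing with \<open>\<i> * q\<close>
    gives the imaginary part.\<close>
  have zero: "(\<Sum>k. cnj (r k) * q k * of_real (u k)) = 0" if q: "q \<in> S" for q
  proof -
    have "summable (\<lambda>k. cnj (r k) * q k * of_real (u k))"
      using Cauchy_Schwarz_l2w(1)[OF u0 r Sl[OF q]] u0
      by (intro summable_norm_cancel[where f="\<lambda>k. cnj (r k) * q k * of_real (u k)"]) (simp add: norm_mult)
    from suminf_mult[OF this, of \<i>]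
    have "(\<Sum>k. cnj (r k) * (\<i> * q k) * of_real (u k)) = \<i> * (\<Sum>k. cnj (r k) * q k * of_real (u k))"
      by (simp add: algebra_simps)
    with Re0[OF scale[OF q, of \<i>]] have "Im (\<Sum>k. cnj (r k) * q k * of_real (u k)) = 0"
      by simp
    with Re0[OF q] show ?thesis by (simp add: complex_eq_iff)
  qed
  have "(\<lambda>k. cnj (r k)) \<in> l2w u" using r by (simp add: l2w_def)
  from ann[OF this zero] have "t = s'" by (auto simp: r_def fun_eq_iff)
  moreover obtain k where "\<epsilon> k < e"
    using order_tendstoD(2)[OF \<epsilon> e] by (auto simp: eventually_sequentially)
  ultimately have "l2norm u (\<lambda>n. t n - s k n) < e"
    using lim[of k] l2norm_minus_commute[of u "s k" s'] by simp
  with sS show ?thesis by blast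
qed

section \<open>Potentials of summable masses in the plane\<close>

text \<open>On the annulus where the modulus lies between \<open>(1/2)^(k+1)\<close> and
  \<open>(1/2)^k\<close> the quotient is below \<open>2^(k+1)\<close>, which is the
  \<open>k\<close>-th term of the series. The summand 1 takes care of large
  \<open>z\<close>.\<close>

lemma inverse_norm_le_dyadic:
  fixes z :: complex
  shows "ennreal (1 / cmod z) \<le> 1 + (\<Sum>k. ennreal (2 ^ Suc k) * indicator (cball 0 ((1/2) ^ k)) z)"
proof (cases "z = 0 \<or> 1 < cmod z")
  case True
  \<comment> \<open>At \<open>z = 0\<close> the quotient has its default value 0.\<close>
  then have "1 / cmod z \<le> 1" by (auto simp: divide_simps)
  then have "ennreal (1 / cmod z) \<le> 1" by simp
  then show ?thesis by (meson add_increasing2 order_trans zero_le le_iff_add)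
next
  case False
  then have z: "0 < cmod z" "cmod z \<le> 1" by auto
  have ex: "\<exists>k. (1/2) ^ k < cmod z" using real_arch_pow_inv[OF z(1), of "1/2"] by simp
  \<comment> \<open>The least exponent whose disc misses \<open>z\<close>; the disc of its
    predecessor \<open>k\<close> contains \<open>z\<close>, which places \<open>z\<close> in the
    \<open>k\<close>-th annulus.\<close>
  define m where "m = (LEAST k. (1/2) ^ k < cmod z)"
  have m: "(1/2) ^ m < cmod z" unfolding m_def by (rule LeastI_ex[OF ex])
  then have "m \<noteq> 0" using z by (metis not_le power_0)
  then obtain k where k: "m = Suc k" by (cases m) auto
  have "\<not> (1/2) ^ k < cmod z" using not_less_Least[of k "\<lambda>k. (1/2) ^ k < cmod z"] k m_def by simp
  then have mem: "z \<in> cball 0 ((1/2) ^ k)" by simp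
  have "1 / cmod z \<le> 2 ^ Suc k"
    using m z unfolding k by (simp add: field_simps power_one_over)
  then have "ennreal (1 / cmod z) \<le> ennreal (2 ^ Suc k)" by (rule ennreal_leI)
  also have "\<dots> = (\<Sum>i\<in>{k}. ennreal (2 ^ Suc i) * indicator (cball 0 ((1/2) ^ i)) z)" using mem by simp
  also have "\<dots> \<le> (\<Sum>k. ennreal (2 ^ Suc k) * indicator (cball 0 ((1/2) ^ k)) z)"
    by (rule sum_le_suminf) auto
  finally show ?thesis by (meson add_increasing zero_le order_trans)
qed

text \<open>A disc of radius \<open>(1/2)^k\<close> has area \<open>pi / 4^k\<close>, so the dyadic
  terms contribute \<open>2 * pi / 2^k\<close> each and \<open>4 * pi\<close> together; the unit
  disc adds \<open>pi\<close>. The bound is the same for all \<open>g\<close>.\<close>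

lemma nn_integral_inverse_dist_cball:
  fixes g :: complex
  shows "(\<integral>\<^sup>+ z. ennreal (1 / cmod (g - z)) * indicator (cball 0 1) z \<partial>lborel) \<le> ennreal (5 * pi)"
proof -
  have vol: "emeasure lborel (cball (c::complex) r) = ennreal (pi * r\<^sup>2)" if "0 \<le> r" for c r
    using emeasure_cball[OF that, of c] by (simp add: unit_ball_vol_2)
  have [measurable]: "cball (c::complex) r \<in> sets borel" for c r by simp
  have ind: "indicator (cball 0 r) (g - z) = indicator (cball g r) z" for r z
    by (auto simp: indicator_def dist_norm norm_minus_commute)
  have "(\<integral>\<^sup>+ z. ennreal (1 / cmod (g - z)) * indicator (cball 0 1) z \<partial>lborel)
     \<le> (\<integral>\<^sup>+ z. indicator (cball 0 1) z
          + (\<Sum>k. ennreal (2 ^ Suc k) * indicator (cball g ((1/2) ^ k)) z) \<partial>lborel)"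
  proof (rule nn_integral_mono)
    fix z :: complex
    show "ennreal (1 / cmod (g - z)) * indicator (cball 0 1) z
      \<le> indicator (cball 0 1) z + (\<Sum>k. ennreal (2 ^ Suc k) * indicator (cball g ((1/2) ^ k)) z)"
      using inverse_norm_le_dyadic[of "g - z"] unfolding ind
      by (cases "z \<in> cball 0 1") auto
  qed
  also have "\<dots> = emeasure lborel (cball (0::complex) 1)
       + (\<Sum>k. ennreal (2 ^ Suc k) * emeasure lborel (cball g ((1/2) ^ k)))"
  proof -
    have m: "(\<lambda>z. ennreal (2 ^ Suc k) * indicator (cball g ((1/2) ^ k)) z) \<in> borel_measurable lborel" for k
      by measurable
    have "(\<integral>\<^sup>+ z. ennreal (2 ^ Suc k) * indicator (cball g ((1/2) ^ k)) z \<partial>lborel)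
        = ennreal (2 ^ Suc k) * emeasure lborel (cball g ((1/2) ^ k))" for k
      by (rule nn_integral_cmult_indicator) simp
    moreover have "(\<integral>\<^sup>+ z. indicator (cball (0::complex) 1) z \<partial>lborel) = emeasure lborel (cball (0::complex) 1)"
      by (subst nn_integral_indicator) simp_all
    moreover have "(\<lambda>z. indicator (cball (0::complex) 1) z :: ennreal) \<in> borel_measurable lborel"
      by measurable
    ultimately show ?thesis
      using nn_integral_suminf[OF m] by (subst nn_integral_add) (simp_all only: borel_measurable_suminf_order[OF m])
  qed
  also have "(\<Sum>k. ennreal (2 ^ Suc k) * emeasure lborel (cball g ((1/2) ^ k)))
       = (\<Sum>k. ennreal (2 * pi * (1/2) ^ k))"
    by (intro suminf_cong)
       (simp add: vol ennreal_mult[symmetric] power_mult_distrib power2_eq_square power_one_over field_simps)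
  also have "\<dots> = ennreal (2 * pi * 2)"
  proof -
    have "(\<lambda>k. 2 * pi * (1/2) ^ k) sums (2 * pi * (1 / (1 - 1/2)))"
      by (intro sums_mult geometric_sums) simp
    then show ?thesis by (intro suminf_ennreal_eq) auto
  qed
  also have "emeasure lborel (cball (0::complex) 1) + ennreal (2 * pi * 2) = ennreal (5 * pi)"
    by (simp add: vol flip: ennreal_plus)
  finally show ?thesis .
qed

text \<open>Works because \<open>1 / \<bar>\<gamma> - z\<bar>\<close> is locally integrable in the plane, uniformly in \<open>\<gamma>\<close>.\<close>

lemma AE_potentials_tendsto_0:
  fixes c :: "nat \<Rightarrow> nat \<Rightarrow> real" and G :: "nat \<Rightarrow> complex"
  assumes c: "\<And>k m. 0 \<le> c k m" and s: "\<And>k. summable (c k)" and ss: "summable (\<lambda>k. \<Sum>m. c k m)"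
  shows "AE z in lborel. z \<in> cball 0 1 \<longrightarrow>
     (\<forall>k. summable (\<lambda>m. c k m / cmod (G m - z))) \<and>
     (\<lambda>k. \<Sum>m. c k m / cmod (G m - z)) \<longlonglongrightarrow> 0"
proof -
  \<comment> \<open>The integral of \<open>F\<close> is at most \<open>5 * pi\<close> times the
    total mass of \<open>c\<close>, so \<open>F\<close> is finite almost everywhere. At such a point
    the series of potentials over \<open>k\<close> converges, and hence its terms tend to 0.\<close>
  define F where "F = (\<lambda>z. \<Sum>k. \<Sum>m. ennreal (c k m / cmod (G m - z)) * indicator (cball 0 1) z)"
  have [measurable]: "cball (0::complex) 1 \<in> sets borel" by simp
  have meas: "(\<lambda>z. ennreal (c k m / cmod (G m - z)) * indicator (cball 0 1) z) \<in> borel_measurable lborel" for k m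
    by measurable
  have Fm: "F \<in> borel_measurable lborel"
    unfolding F_def by (intro borel_measurable_suminf_order meas)
  have "(\<integral>\<^sup>+ z. F z \<partial>lborel)
     = (\<Sum>k. \<Sum>m. \<integral>\<^sup>+ z. ennreal (c k m / cmod (G m - z)) * indicator (cball 0 1) z \<partial>lborel)"
    unfolding F_def
    by (simp only: nn_integral_suminf[OF meas] nn_integral_suminf[OF borel_measurable_suminf_order[OF meas]])
  also have "\<dots> \<le> (\<Sum>k. \<Sum>m. ennreal (c k m) * ennreal (5 * pi))"
  proof (intro suminf_le allI)
    fix k m
    have "(\<integral>\<^sup>+ z. ennreal (c k m / cmod (G m - z)) * indicator (cball 0 1) z \<partial>lborel)
       = (\<integral>\<^sup>+ z. ennreal (c k m) * (ennreal (1 / cmod (G m - z)) * indicator (cball 0 1) z) \<partial>lborel)"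
      using c by (intro nn_integral_cong) (simp add: ennreal_mult[symmetric] mult.assoc[symmetric])
    also have "\<dots> = ennreal (c k m) * (\<integral>\<^sup>+ z. ennreal (1 / cmod (G m - z)) * indicator (cball 0 1) z \<partial>lborel)"
      by (rule nn_integral_cmult) measurable
    also have "\<dots> \<le> ennreal (c k m) * ennreal (5 * pi)"
      by (intro mult_left_mono nn_integral_inverse_dist_cball) simp
    finally show "(\<integral>\<^sup>+ z. ennreal (c k m / cmod (G m - z)) * indicator (cball 0 1) z \<partial>lborel)
        \<le> ennreal (c k m) * ennreal (5 * pi)" .
  qed auto
  also have "\<dots> = (\<Sum>k. \<Sum>m. ennreal (c k m)) * ennreal (5 * pi)"
    by simp
  also have "(\<Sum>k. \<Sum>m. ennreal (c k m)) = ennreal (\<Sum>k. \<Sum>m. c k m)"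
    by (subst suminf_ennreal2[OF c s], subst suminf_ennreal2[OF _ ss]) (auto intro!: suminf_nonneg c s)
  also have "\<dots> * ennreal (5 * pi) < \<infinity>" by (simp add: ennreal_mult_less_top)
  finally have "(\<integral>\<^sup>+ z. F z \<partial>lborel) \<noteq> \<infinity>" by simp
  from nn_integral_PInf_AE[OF Fm this] have "AE z in lborel. F z \<noteq> \<infinity>" .
  then show ?thesis
  proof eventually_elim
    case (elim z)
    show ?case
    proof
      assume z: "z \<in> cball 0 1"
      have c': "0 \<le> c k m / cmod (G m - z)" for k m using c by simp
      have F: "(\<Sum>k. \<Sum>m. ennreal (c k m / cmod (G m - z))) \<noteq> top"
        using elim z by (simp add: F_def)
      have "(\<Sum>m. ennreal (c k m / cmod (G m - z))) \<noteq> top" for k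
      proof
        assume "(\<Sum>m. ennreal (c k m / cmod (G m - z))) = top"
        moreover have "(\<Sum>i\<in>{k}. \<Sum>m. ennreal (c i m / cmod (G m - z)))
             \<le> (\<Sum>k. \<Sum>m. ennreal (c k m / cmod (G m - z)))"
          by (rule sum_le_suminf) auto
        ultimately show False using F by (simp add: top_unique)
      qed
      then have s': "summable (\<lambda>m. c k m / cmod (G m - z))" for k
        by (intro summable_suminf_not_top c')
      have "(\<Sum>k. ennreal (\<Sum>m. c k m / cmod (G m - z))) \<noteq> top"
        using F by (simp add: suminf_ennreal2[OF c' s'])
      then have "summable (\<lambda>k. \<Sum>m. c k m / cmod (G m - z))"
        by (intro summable_suminf_not_top suminf_nonneg c' s')
      then show "(\<forall>k. summable (\<lambda>m. c k m / cmod (G m - z))) \<and>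
          (\<lambda>k. \<Sum>m. c k m / cmod (G m - z)) \<longlonglongrightarrow> 0"
        using s' summable_LIMSEQ_zero by blast
    qed
  qed
qed

text \<open>Countable sets are null while the disc has positive area, so an admissible point can be
  chosen off the nodes and the interpolation points.\<close>

lemma AE_imp_ex_in_cball:
  fixes C :: "complex set"
  assumes ae: "AE z in lborel. z \<in> cball 0 1 \<longrightarrow> P z" and C: "countable C"
  shows "\<exists>z. z \<notin> C \<and> P z"
proof (rule ccontr)
  assume none: "\<not> ?thesis"
  have "AE z in lborel. z \<notin> C"
    using countable_imp_null_set_lborel[OF C] by (rule AE_not_in)
  with ae have "AE z in lborel. z \<notin> cball (0::complex) 1"
    by eventually_elim (use none in auto)
  then have "emeasure lborel (cball (0::complex) 1) = 0"
    by (subst (asm) AE_iff_measurable[where N="cball 0 1"]) auto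
  then show False using emeasure_cball[of 1 "0::complex"] by (simp add: unit_ball_vol_2)
qed

section \<open>Proportionality of the dual vectors\<close>

text \<open>Inductive form of the span, so that membership in \<open>l2w v\<close> and the vanishing
  of pairings pass from the kernels to the span by rule induction.\<close>

inductive_set lin_span :: "(nat \<Rightarrow> nat \<Rightarrow> complex) \<Rightarrow> (nat \<Rightarrow> complex) set" for r where
  base: "r i \<in> lin_span r"
| add: "a \<in> lin_span r \<Longrightarrow> b \<in> lin_span r \<Longrightarrow> (\<lambda>k. a k + b k) \<in> lin_span r"
| scale: "a \<in> lin_span r \<Longrightarrow> (\<lambda>k. c * a k) \<in> lin_span r"

abbreviation cauchy_kernel :: "(nat \<Rightarrow> complex) \<Rightarrow> complex \<Rightarrow> nat \<Rightarrow> complex" where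
  "cauchy_kernel G z \<equiv> \<lambda>m. 1 / (z - G m)"

text \<open>Also interpreted with the two roles exchanged, as
  \<open>cauchy_nodes L \<omega> G\<close>, which makes linearity available for the dual
  transform.\<close>

locale cauchy_nodes =
  fixes G :: "nat \<Rightarrow> complex" and v :: "nat \<Rightarrow> real" and L :: "nat \<Rightarrow> complex"
  assumes v_pos: "\<forall>n. 0 < v n"
    and L_star: "range L \<subseteq> star_set G v"
begin

section \<open>Cauchy transforms and density of the kernels\<close>

lemma v_nonneg: "\<forall>n. 0 \<le> v n"
  using v_pos by (simp add: less_imp_le)

lemma L_in_star: "L i \<in> star_set G v"
  using L_star by auto

lemma L_neq_G [simp]: "L i \<noteq> G m" "G m \<noteq> L i"
  using L_in_star[of i] by (auto simp: star_set_def) (metis rangeI)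

lemma cauchy_kernel_l2w:
  assumes "z \<in> star_set G v"
  shows "cauchy_kernel G z \<in> l2w v"
proof -
  have eq: "(cmod (1 / (z - G n)))\<^sup>2 * v n = v n / (cmod (z - G n))\<^sup>2" for n
    by (simp add: norm_divide power_divide)
  show ?thesis
    using assms by (simp only: l2w_def mem_Collect_eq eq) (simp add: star_set_def)
qed

lemma summable_Hfun:
  assumes "a \<in> l2w v" "z \<in> star_set G v"
  shows "summable (\<lambda>n. cmod (a n * complex_of_real (v n) / (z - G n)))"
    "summable (\<lambda>n. a n * complex_of_real (v n) / (z - G n))"
proof -
  show *: "summable (\<lambda>n. cmod (a n * complex_of_real (v n) / (z - G n)))"
    using Cauchy_Schwarz_l2w(1)[OF v_nonneg assms(1) cauchy_kernel_l2w[OF assms(2)]] v_nonneg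
    by (simp add: norm_mult norm_divide)
  show "summable (\<lambda>n. a n * complex_of_real (v n) / (z - G n))"
    by (rule summable_norm_cancel[OF *])
qed

lemma Hfun_bound:
  assumes "a \<in> l2w v" "z \<in> star_set G v"
  shows "cmod (Hfun G v a z) \<le> l2norm v a * l2norm v (cauchy_kernel G z)"
proof -
  have "cmod (Hfun G v a z) \<le> (\<Sum>n. cmod (a n * complex_of_real (v n) / (z - G n)))"
    unfolding Hfun_def by (rule summable_norm[OF summable_Hfun(1)[OF assms]])
  also have "\<dots> \<le> l2norm v a * l2norm v (cauchy_kernel G z)"
    using Cauchy_Schwarz_l2w(2)[OF v_nonneg assms(1) cauchy_kernel_l2w[OF assms(2)]] v_nonneg
    by (simp add: norm_mult norm_divide)
  finally show ?thesis .
qed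

lemma Hfun_add_scale:
  assumes "a \<in> l2w v" "b \<in> l2w v" "z \<in> star_set G v"
  shows "Hfun G v (\<lambda>n. a n + c * b n) z = Hfun G v a z + c * Hfun G v b z"
proof -
  have "Hfun G v a z + c * Hfun G v b z
     = (\<Sum>n. a n * complex_of_real (v n) / (z - G n) + c * (b n * complex_of_real (v n) / (z - G n)))"
    unfolding Hfun_def
    by (simp only: suminf_mult[OF summable_Hfun(2)[OF assms(2,3)], symmetric]
        suminf_add[OF summable_Hfun(2)[OF assms(1,3)] summable_mult[OF summable_Hfun(2)[OF assms(2,3)]]])
  then show ?thesis by (simp add: Hfun_def add_divide_distrib distrib_right mult.assoc)
qed

lemma lin_span_kernels_subset: "lin_span (\<lambda>i. cauchy_kernel G (L i)) \<subseteq> l2w v"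
proof
  fix f assume "f \<in> lin_span (\<lambda>i. cauchy_kernel G (L i))"
  then show "f \<in> l2w v"
    by induction (auto intro: cauchy_kernel_l2w[OF L_in_star] l2w_add(1)[OF v_nonneg] l2w_scale(1))
qed

text \<open>Pairing \<open>a\<close> with the kernel at \<open>L i\<close> gives
  \<open>Hfun G v a (L i)\<close>. Uniqueness therefore says exactly that the kernels have trivial
  annihilator.\<close>

lemma kernels_dense:
  assumes "uniqueness_seq G v L" "t \<in> l2w v" "0 < e"
  shows "\<exists>f\<in>lin_span (\<lambda>i. cauchy_kernel G (L i)). l2norm v (\<lambda>m. t m - f m) < e"
proof (rule dense_if_annihilator_trivial[OF v_pos lin_span_kernels_subset _ _ _ _ assms(2,3)])
  show "lin_span (\<lambda>i. cauchy_kernel G (L i)) \<noteq> {}" using lin_span.base by blast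
next
  fix a assume a: "a \<in> l2w v"
    and z: "\<And>s. s \<in> lin_span (\<lambda>i. cauchy_kernel G (L i)) \<Longrightarrow> (\<Sum>k. a k * s k * complex_of_real (v k)) = 0"
  have "Hfun G v a (L j) = 0" for j
    using z[OF lin_span.base[of "\<lambda>i. cauchy_kernel G (L i)" j]] by (simp add: Hfun_def)
  then show "a = (\<lambda>_. 0)" using assms(1) a by (auto simp: uniqueness_seq_def)
qed (auto intro: lin_span.intros)

text \<open>A substitute for Cauchy-Schwarz when \<open>t m / (G m - z)\<close> leaves
  \<open>l2w v\<close>: this sequence still pairs absolutely with every kernel and with the errors
  of the approximations \<open>f n k\<close> to \<open>unit_seq n\<close>, and the latter pairings
  tend to 0.\<close>

definition good :: "(nat \<Rightarrow> nat \<Rightarrow> nat \<Rightarrow> complex) \<Rightarrow> (nat \<Rightarrow> complex) \<Rightarrow> complex \<Rightarrow> bool" where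
  "good f t z \<longleftrightarrow>
     (\<forall>i. summable (\<lambda>m. cmod (t m) * cmod (1 / (L i - G m)) * v m / cmod (G m - z))) \<and>
     (\<forall>n. (\<forall>k. summable (\<lambda>m. cmod (t m) * cmod (unit_seq n m - f n k m) * v m / cmod (G m - z))) \<and>
       (\<lambda>k. \<Sum>m. cmod (t m) * cmod (unit_seq n m - f n k m) * v m / cmod (G m - z)) \<longlonglongrightarrow> 0)"

text \<open>The masses are the terms of the pairing of \<open>t\<close> with the errors. By
  Cauchy-Schwarz their sums are at most \<open>l2norm v t * (1/2)^k\<close>, which is summable over
  \<open>k\<close>; this is why the approximations have to be geometrically fast. Only countably
  many null sets are discarded.\<close>

lemma AE_good:
  assumes t: "t \<in> l2w v" and f: "\<And>n k. f n k \<in> l2w v"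
    and close: "\<And>n k. l2norm v (\<lambda>m. unit_seq n m - f n k m) \<le> (1/2) ^ k"
  shows "AE z in lborel. z \<in> cball 0 1 \<longrightarrow> good f t z"
proof -
  have A: "AE z in lborel. z \<in> cball 0 1 \<longrightarrow>
     summable (\<lambda>m. cmod (t m) * cmod (1 / (L i - G m)) * v m / cmod (G m - z))" for i
  proof -
    \<comment> \<open>A single row of masses, padded with zero rows so that the result on families
      applies.\<close>
    define c where "c = (\<lambda>k m. if k = (0::nat) then cmod (t m) * cmod (1 / (L i - G m)) * v m else 0)"
    have c0: "0 \<le> c k m" for k m using v_nonneg by (simp add: c_def)
    have s: "summable (c k)" for k
      unfolding c_def
      using Cauchy_Schwarz_l2w(1)[OF v_nonneg t cauchy_kernel_l2w[OF L_in_star[of i]]] by (cases "k = 0") auto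
    have ss: "summable (\<lambda>k. \<Sum>m. c k m)"
      by (rule summable_finite[of "{0}"]) (auto simp: c_def)
    have "AE z in lborel. z \<in> cball 0 1 \<longrightarrow> (\<forall>k. summable (\<lambda>m. c k m / cmod (G m - z)))"
      using AE_potentials_tendsto_0[where c=c and G=G, OF c0 s ss] by eventually_elim blast
    then show ?thesis
    proof eventually_elim
      case (elim z)
      then show ?case using spec[of "\<lambda>k. summable (\<lambda>m. c k m / cmod (G m - z))" 0] by (auto simp: c_def)
    qed
  qed
  have B: "AE z in lborel. z \<in> cball 0 1 \<longrightarrow>
     (\<forall>k. summable (\<lambda>m. cmod (t m) * cmod (unit_seq n m - f n k m) * v m / cmod (G m - z))) \<and>
       (\<lambda>k. \<Sum>m. cmod (t m) * cmod (unit_seq n m - f n k m) * v m / cmod (G m - z)) \<longlonglongrightarrow> 0" for n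
  proof (rule AE_potentials_tendsto_0)
    have d: "(\<lambda>m. unit_seq n m - f n k m) \<in> l2w v" for k
      by (intro l2w_diff v_nonneg f) simp
    note CS = Cauchy_Schwarz_l2w[OF v_nonneg t d]
    show nn: "0 \<le> cmod (t m) * cmod (unit_seq n m - f n k m) * v m" for k m using v_nonneg by simp
    show "summable (\<lambda>m. cmod (t m) * cmod (unit_seq n m - f n k m) * v m)" for k by (rule CS(1))
    show "summable (\<lambda>k. \<Sum>m. cmod (t m) * cmod (unit_seq n m - f n k m) * v m)"
    proof (rule summable_comparison_test')
      show "summable (\<lambda>k. l2norm v t * (1/2) ^ k)" by (intro summable_mult summable_geometric) simp
      fix k
      have "(\<Sum>m. cmod (t m) * cmod (unit_seq n m - f n k m) * v m) \<le> l2norm v t * (1/2) ^ k"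
        using CS(2)[of k] mult_left_mono[OF close[of n k] l2norm_nonneg[OF v_nonneg t]] by linarith
      moreover have "0 \<le> (\<Sum>m. cmod (t m) * cmod (unit_seq n m - f n k m) * v m)"
        by (intro suminf_nonneg CS(1) nn)
      ultimately show "norm (\<Sum>m. cmod (t m) * cmod (unit_seq n m - f n k m) * v m) \<le> l2norm v t * (1/2) ^ k"
        by simp
    qed
  qed
  have "AE z in lborel. \<forall>i. z \<in> cball 0 1 \<longrightarrow>
     summable (\<lambda>m. cmod (t m) * cmod (1 / (L i - G m)) * v m / cmod (G m - z))"
    unfolding AE_all_countable using A by blast
  moreover have "AE z in lborel. \<forall>n. z \<in> cball 0 1 \<longrightarrow>
     (\<forall>k. summable (\<lambda>m. cmod (t m) * cmod (unit_seq n m - f n k m) * v m / cmod (G m - z))) \<and>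
       (\<lambda>k. \<Sum>m. cmod (t m) * cmod (unit_seq n m - f n k m) * v m / cmod (G m - z)) \<longlonglongrightarrow> 0"
    unfolding AE_all_countable using B by blast
  ultimately show ?thesis
    by eventually_elim (auto simp: good_def)
qed

text \<open>Goodness depends only on moduli up to a constant. The null set can thus be fixed for one
  majorant in advance, although the combinations used later have coefficients that depend on
  \<open>z\<close>.\<close>

lemma good_mono:
  assumes good: "good f s z" and le: "\<And>m. cmod (t m) \<le> K * cmod (s m)"
  shows "good f t z"
proof -
  have le': "cmod (t m) * x * v m / y \<le> K * (cmod (s m) * x * v m / y)"
    if "0 \<le> x" "0 \<le> y" for m x y
  proof -
    have "cmod (t m) * (x * v m / y) \<le> (K * cmod (s m)) * (x * v m / y)"
      using that v_nonneg by (intro mult_right_mono le) auto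
    then show ?thesis by (simp add: mult.assoc)
  qed
  have sum: "summable (\<lambda>m. cmod (t m) * X m * v m / Y m)"
    if "summable (\<lambda>m. cmod (s m) * X m * v m / Y m)" "\<And>m. 0 \<le> X m" "\<And>m. 0 \<le> Y m"
    for X Y :: "nat \<Rightarrow> real"
    by (rule summable_comparison_test'[OF summable_mult[OF that(1), of K], of 0])
       (use le' that v_nonneg in auto)
  let ?S = "\<lambda>n a k. \<Sum>m. cmod (a m) * cmod (unit_seq n m - f n k m) * v m / cmod (G m - z)"
  have g: "summable (\<lambda>m. cmod (s m) * cmod (unit_seq n m - f n k m) * v m / cmod (G m - z))" for n k
    using good by (simp add: good_def)
  have g': "summable (\<lambda>m. cmod (t m) * cmod (unit_seq n m - f n k m) * v m / cmod (G m - z))" for n k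
    by (rule sum[OF g]) auto
  have "(\<lambda>k. ?S n t k) \<longlonglongrightarrow> 0" for n
  proof (rule tendsto_sandwich[where f="\<lambda>_. 0" and h="\<lambda>k. K * ?S n s k"])
    show "(\<lambda>k. K * ?S n s k) \<longlonglongrightarrow> 0"
      using good unfolding good_def by (intro tendsto_mult_right_zero) blast
    have "?S n t k \<le> K * ?S n s k" for k
      unfolding suminf_mult[OF g, symmetric]
      by (intro suminf_le g' summable_mult g le') auto
    then show "\<forall>\<^sub>F k in sequentially. ?S n t k \<le> K * ?S n s k" by simp
    have "0 \<le> ?S n t k" for k using v_nonneg by (intro suminf_nonneg g') auto
    then show "\<forall>\<^sub>F k in sequentially. 0 \<le> ?S n t k" by simp
  qed auto
  moreover have "summable (\<lambda>m. cmod (t m) * cmod (1 / (L i - G m)) * v m / cmod (G m - z))" for i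
    by (rule sum) (use good in \<open>auto simp: good_def\<close>)
  ultimately show ?thesis
    using g' unfolding good_def by blast
qed

lemma summable_weighted_quotient:
  assumes "good f t z" "z \<noteq> L i"
  shows "summable (\<lambda>m. t m * complex_of_real (v m) / ((G m - z) * (L i - G m)))"
proof (rule summable_norm_cancel)
  show "summable (\<lambda>m. norm (t m * complex_of_real (v m) / ((G m - z) * (L i - G m))))"
    using assms(1) v_nonneg by (simp add: good_def norm_mult norm_divide mult_ac)
qed

text \<open>The sequence \<open>b\<close> need not lie in \<open>l2w v\<close>; a good point \<open>z\<close> makes up for this, because the
  error terms arising from the approximation of \<open>unit_seq n\<close> then still tend to zero.\<close>

lemma annihilator_trivial_at_good_point:
  assumes f: "\<And>n k. f n k \<in> lin_span (\<lambda>i. cauchy_kernel G (L i))"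
    and close: "\<And>n k. l2norm v (\<lambda>m. unit_seq n m - f n k m) \<le> (1/2) ^ k"
    and s: "s \<in> l2w v" and t: "good f t z" and z: "\<And>i. z \<noteq> L i"
    and b: "\<And>m. b m = s m + t m / (G m - z)"
    and zero: "\<And>i. (\<Sum>m. b m * complex_of_real (v m) / (L i - G m)) = 0"
  shows "b = (\<lambda>_. 0)"
proof
  fix n
  have fl: "f n k \<in> l2w v" for n k using f lin_span_kernels_subset by blast
  \<comment> \<open>Summability is carried through the induction together with the value, since sums
    of series may only be split when both parts converge.\<close>
  have span: "summable (\<lambda>m. b m * q m * complex_of_real (v m)) \<and> (\<Sum>m. b m * q m * complex_of_real (v m)) = 0"
    if "q \<in> lin_span (\<lambda>i. cauchy_kernel G (L i))" for q
    using that
  proof induction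
    case (base i)
    have "summable (\<lambda>m. s m * complex_of_real (v m) / (L i - G m)
        + t m * complex_of_real (v m) / ((G m - z) * (L i - G m)))"
      by (intro summable_add summable_Hfun s L_in_star summable_weighted_quotient[OF t z])
    moreover have "b m * complex_of_real (v m) / (L i - G m) = s m * complex_of_real (v m) / (L i - G m)
        + t m * complex_of_real (v m) / ((G m - z) * (L i - G m))" for m
      by (simp add: b distrib_right add_divide_distrib)
    ultimately show ?case using zero[of i] by simp
  next
    case (add p q)
    then show ?case
      using summable_add[of "\<lambda>m. b m * p m * complex_of_real (v m)" "\<lambda>m. b m * q m * complex_of_real (v m)"]
        suminf_add[of "\<lambda>m. b m * p m * complex_of_real (v m)" "\<lambda>m. b m * q m * complex_of_real (v m)"]
      by (simp add: algebra_simps)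
  next
    case (scale q c)
    then show ?case
      using summable_mult[of "\<lambda>m. b m * q m * complex_of_real (v m)" c]
        suminf_mult[of "\<lambda>m. b m * q m * complex_of_real (v m)" c]
      by (simp add: algebra_simps)
  qed
  let ?d = "\<lambda>k m. unit_seq n m - f n k m"
  let ?T = "\<lambda>k m. cmod (t m) * cmod (?d k m) * v m / cmod (G m - z)"
  \<comment> \<open>As \<open>b\<close> annihilates \<open>f n k\<close>, its weighted
    \<open>n\<close>-th entry is its pairing with the error \<open>?d k\<close>. Cauchy-Schwarz
    bounds the part from \<open>s\<close>, and goodness controls the part from
    \<open>t\<close>.\<close>
  have bound: "cmod (b n) * v n \<le> l2norm v s * (1/2) ^ k + suminf (?T k)" for k
  proof -
    have us: "(\<lambda>m. b m * unit_seq n m * complex_of_real (v m)) sums (b n * complex_of_real (v n))"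
      using sums_single[of n "\<lambda>m. b m * complex_of_real (v m)"]
      by (rule back_subst[where P="\<lambda>g. g sums _"]) (auto simp: unit_seq_def)
    have "(\<lambda>m. b m * ?d k m * complex_of_real (v m)) sums (b n * complex_of_real (v n) - 0)"
    proof -
      have "(\<lambda>m. b m * f n k m * complex_of_real (v m)) sums 0"
        using span[OF f[of n k]] by (simp add: sums_iff)
      from sums_diff[OF us this] show ?thesis by (simp add: algebra_simps)
    qed
    then have eq: "b n * complex_of_real (v n) = (\<Sum>m. b m * ?d k m * complex_of_real (v m))"
      by (simp add: sums_iff)
    have dl: "?d k \<in> l2w v" by (intro l2w_diff v_nonneg fl) simp
    note CS = Cauchy_Schwarz_l2w[OF v_nonneg s dl]
    have Ts: "summable (?T k)" using t by (simp add: good_def)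
    have le: "norm (b m * ?d k m * complex_of_real (v m)) \<le> cmod (s m) * cmod (?d k m) * v m + ?T k m" for m
    proof -
      have "norm (b m * ?d k m * complex_of_real (v m)) = cmod (s m + t m / (G m - z)) * (cmod (?d k m) * v m)"
        using v_nonneg by (simp add: b norm_mult)
      also have "\<dots> \<le> (cmod (s m) + cmod (t m / (G m - z))) * (cmod (?d k m) * v m)"
        using v_nonneg by (intro mult_right_mono norm_triangle_ineq) auto
      finally show ?thesis by (simp add: norm_divide algebra_simps)
    qed
    have "cmod (b n) * v n = norm (b n * complex_of_real (v n))"
      using v_nonneg by (simp add: norm_mult)
    also have "\<dots> \<le> (\<Sum>m. cmod (s m) * cmod (?d k m) * v m + ?T k m)"
      unfolding eq by (intro norm_suminf_le le summable_add CS(1) Ts)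
    also have "\<dots> = (\<Sum>m. cmod (s m) * cmod (?d k m) * v m) + suminf (?T k)"
      by (rule suminf_add[OF CS(1) Ts, symmetric])
    also have "(\<Sum>m. cmod (s m) * cmod (?d k m) * v m) \<le> l2norm v s * (1/2) ^ k"
      using CS(2) mult_left_mono[OF close[of n k] l2norm_nonneg[OF v_nonneg s]] by linarith
    finally show ?thesis by simp
  qed
  have lim: "(\<lambda>k. l2norm v s * (1/2) ^ k + suminf (?T k)) \<longlonglongrightarrow> l2norm v s * 0 + 0"
    using t unfolding good_def
    by (intro tendsto_add tendsto_mult tendsto_const LIMSEQ_realpow_zero) auto
  have "cmod (b n) * v n \<le> l2norm v s * 0 + 0"
    by (rule tendsto_lowerbound[OF lim]) (use bound in auto)
  then show "b n = 0"
    using v_pos by (auto simp: mult_le_0_iff) (metis less_le_not_le)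
qed

text \<open>Partial fractions: \<open>(L i - z) / ((G m - z) * (L i - G m)) = 1 / (G m - z) + 1 / (L
  i - G m)\<close>. If \<open>p = L j\<close> and the transform of \<open>a\<close> vanishes at all
  other points, then \<open>(L i - p) * Hfun G v a (L i)\<close> is zero for every \<open>i\<close>,
  and a multiple of \<open>1 / (L i - z)\<close> remains.\<close>

lemma Hfun_quotient:
  assumes a: "a \<in> l2w v" and t: "good f a z" and z: "z \<noteq> L i" "z \<notin> range G"
  shows "(\<lambda>m. (a m + (z - p) * a m / (G m - z)) * complex_of_real (v m) / (L i - G m)) sums
     (((L i - p) * Hfun G v a (L i) + (z - p) * (\<Sum>m. a m * complex_of_real (v m) / (G m - z))) / (L i - z))"
proof -
  define A where "A = (\<lambda>m. a m * complex_of_real (v m) / (L i - G m))"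
  define Q where "Q = (\<lambda>m. a m * complex_of_real (v m) / ((G m - z) * (L i - G m)))"
  have A: "summable A" unfolding A_def by (rule summable_Hfun[OF a L_in_star])
  have Q: "summable Q" unfolding Q_def by (rule summable_weighted_quotient[OF t z(1)])
  have Gz: "G m - z \<noteq> 0" for m using z(2) by auto
  have LG: "L i - G m \<noteq> 0" for m by simp
  have "a m * complex_of_real (v m) / (G m - z) = (L i - z) * Q m - A m" for m
    using Gz[of m] LG[of m] by (simp add: A_def Q_def divide_simps) (simp add: algebra_simps)
  then have V: "(\<Sum>m. a m * complex_of_real (v m) / (G m - z)) = (L i - z) * suminf Q - Hfun G v a (L i)"
    using suminf_diff[OF summable_mult[OF Q, of "L i - z"] A] suminf_mult[OF Q, of "L i - z"]
    by (simp add: Hfun_def A_def)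
  have eq: "(a m + (z - p) * a m / (G m - z)) * complex_of_real (v m) / (L i - G m) = A m + (z - p) * Q m" for m
    by (simp add: A_def Q_def distrib_right add_divide_distrib)
  have "(\<lambda>m. A m + (z - p) * Q m) sums (Hfun G v a (L i) + (z - p) * suminf Q)"
    using A Q unfolding Hfun_def A_def[symmetric] by (intro sums_add sums_mult summable_sums)
  also have "Hfun G v a (L i) + (z - p) * suminf Q
     = ((L i - p) * Hfun G v a (L i) + (z - p) * (\<Sum>m. a m * complex_of_real (v m) / (G m - z))) / (L i - z)"
    unfolding V using z(1) by (simp add: divide_simps) (simp add: algebra_simps)
  finally show ?thesis unfolding eq .
qed

text \<open>At a good point \<open>z\<close> both vectors yield sequences whose Cauchy sums are
  multiples of \<open>1 / (L i - z)\<close>. Cross-multiplying by the constants gives a combination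
  that annihilates all kernels, hence is zero, and the common denominators \<open>G m - z\<close>
  cancel.\<close>

lemma dual_vectors_proportional:
  assumes uniq: "uniqueness_seq G v L"
    and a: "a \<in> l2w v" "a \<noteq> (\<lambda>_. 0)" "\<And>i. i \<noteq> j \<Longrightarrow> Hfun G v a (L i) = 0"
    and a': "a' \<in> l2w v" "a' \<noteq> (\<lambda>_. 0)" "\<And>i. i \<noteq> j' \<Longrightarrow> Hfun G v a' (L i) = 0"
  shows "\<exists>c. c \<noteq> 0 \<and> (\<forall>n. a' n * (G n - L j') = c * (a n * (G n - L j)))"
proof -
  let ?S = "lin_span (\<lambda>i. cauchy_kernel G (L i))"
  let ?P = "\<lambda>n k q. q \<in> ?S \<and> l2norm v (\<lambda>m. unit_seq n m - q m) < (1/2) ^ k"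
  define f where "f = (\<lambda>n k. SOME q. ?P n k q)"
  have "\<exists>q. ?P n k q" for n k
    using kernels_dense[OF uniq unit_seq_l2w[of n], of "(1/2) ^ k"] by auto
  then have fP: "?P n k (f n k)" for n k unfolding f_def by (rule someI_ex)
  have f: "f n k \<in> ?S" for n k using fP by blast
  have close: "l2norm v (\<lambda>m. unit_seq n m - f n k m) \<le> (1/2) ^ k" for n k
    using fP[of n k] by simp
  \<comment> \<open>A common majorant of both vectors, so that one \<open>z\<close> is good for
    both.\<close>
  define \<tau> where "\<tau> = (\<lambda>m. complex_of_real (cmod (a m)) + complex_of_real (cmod (a' m)))"
  have "\<tau> \<in> l2w v"
    unfolding \<tau>_def using a(1) a'(1) by (intro l2w_add v_nonneg) (simp_all add: l2w_def)
  then have ae: "AE z in lborel. z \<in> cball 0 1 \<longrightarrow> good f \<tau> z"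
    by (rule AE_good) (use f lin_span_kernels_subset close in auto)
  obtain z where zC: "z \<notin> range G \<union> range L" and good: "good f \<tau> z"
    using AE_imp_ex_in_cball[OF ae, of "range G \<union> range L"] by auto
  have zL: "z \<noteq> L i" and zG: "z \<notin> range G" "G m - z \<noteq> 0" for i m using zC by auto
  have \<tau>: "cmod (\<tau> m) = cmod (a m) + cmod (a' m)" for m
    by (simp add: \<tau>_def flip: of_real_add)
  have ga: "good f a z" "good f a' z" by (rule good_mono[OF good, of _ 1]; simp add: \<tau>)+
  define V where "V = (\<lambda>a. \<Sum>m. a m * complex_of_real (v m) / (G m - z))"
  \<comment> \<open>This is \<open>a m * (G m - p) / (G m - z)\<close>, written as a sum to match
    the decomposition into \<open>s m + t m / (G m - z)\<close>.\<close>
  define B where "B = (\<lambda>p (a::nat \<Rightarrow> complex) m. a m + (z - p) * a m / (G m - z))"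
  have B: "B p a m = a m * (G m - p) / (G m - z)" for p a m
    using zG(2)[of m] by (simp add: B_def field_simps)
  have HB: "(\<lambda>m. B (L j) x m * complex_of_real (v m) / (L i - G m)) sums ((z - L j) * V x / (L i - z))"
    if "x \<in> l2w v" "good f x z" "\<And>i. i \<noteq> j \<Longrightarrow> Hfun G v x (L i) = 0" for x i j
    using Hfun_quotient[OF that(1,2) zL zG(1), where p="L j", of i] that(3)[of i]
    by (cases "i = j") (auto simp: B_def V_def)
  \<comment> \<open>If the constant vanished, \<open>B (L j) x\<close> itself would annihilate all
    kernels and be zero, and then so would \<open>x\<close>, because \<open>G m\<close> never equals
    \<open>L j\<close>.\<close>
  have V0: "V x \<noteq> 0" if x: "x \<in> l2w v" "good f x z" "\<And>i. i \<noteq> j \<Longrightarrow> Hfun G v x (L i) = 0"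
    "x \<noteq> (\<lambda>_. 0)" for x j
  proof
    assume V: "V x = 0"
    have "B (L j) x = (\<lambda>_. 0)"
    proof (rule annihilator_trivial_at_good_point[OF f close x(1) _ zL])
      show "good f (\<lambda>m. (z - L j) * x m) z"
        by (rule good_mono[OF x(2), of _ "cmod (z - L j)"]) (simp add: norm_mult)
      show "B (L j) x m = x m + (z - L j) * x m / (G m - z)" for m by (simp add: B_def)
      show "(\<Sum>m. B (L j) x m * complex_of_real (v m) / (L i - G m)) = 0" for i
        using HB[OF x(1-3), where i=i] V by (simp add: sums_iff)
    qed
    then have "x m * (G m - L j) / (G m - z) = 0" for m using B[of "L j" x m] by simp
    then have "x m = 0" for m using zG(2)[of m] by (metis L_neq_G(2) divide_eq_0_iff mult_eq_0_iff right_minus_eq)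
    then have "x = (\<lambda>_. 0)" by (simp add: fun_eq_iff)
    with x(4) show False by simp
  qed
  define P where "P = (z - L j) * V a"
  define P' where "P' = (z - L j') * V a'"
  have P0: "P \<noteq> 0" "P' \<noteq> 0"
    using V0[OF a(1) ga(1) a(3,2)] V0[OF a'(1) ga(2) a'(3,2)] zL by (auto simp: P_def P'_def)
  have "(\<lambda>m. P' * B (L j) a m - P * B (L j') a' m) = (\<lambda>_. 0)"
  proof (rule annihilator_trivial_at_good_point[OF f close _ _ zL])
    show "(\<lambda>m. P' * a m - P * a' m) \<in> l2w v"
      by (intro l2w_diff v_nonneg l2w_scale a a')
    show "good f (\<lambda>m. P' * (z - L j) * a m - P * (z - L j') * a' m) z"
    proof (rule good_mono[OF good])
      fix m
      have "cmod (P' * (z - L j) * a m - P * (z - L j') * a' m)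
          \<le> cmod (P' * (z - L j)) * cmod (a m) + cmod (P * (z - L j')) * cmod (a' m)"
        by (rule order_trans[OF norm_triangle_ineq4]) (simp add: norm_mult)
      also have "\<dots> \<le> (cmod (P' * (z - L j)) + cmod (P * (z - L j'))) * cmod (\<tau> m)"
        unfolding \<tau> distrib_left distrib_right by simp
      finally show "cmod (P' * (z - L j) * a m - P * (z - L j') * a' m)
          \<le> (cmod (P' * (z - L j)) + cmod (P * (z - L j'))) * cmod (\<tau> m)" .
    qed
    show "P' * B (L j) a m - P * B (L j') a' m = P' * a m - P * a' m
        + (P' * (z - L j) * a m - P * (z - L j') * a' m) / (G m - z)" for m
      by (simp add: B_def algebra_simps diff_divide_distrib add_divide_distrib)
    fix i
    have "(\<lambda>m. P' * (B (L j) a m * complex_of_real (v m) / (L i - G m))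
        - P * (B (L j') a' m * complex_of_real (v m) / (L i - G m))) sums
        (P' * (P / (L i - z)) - P * (P' / (L i - z)))"
      unfolding P_def P'_def by (intro sums_diff sums_mult HB a a' ga)
    then show "(\<Sum>m. (P' * B (L j) a m - P * B (L j') a' m) * complex_of_real (v m) / (L i - G m)) = 0"
      by (simp add: sums_iff algebra_simps diff_divide_distrib)
  qed
  then have eqB: "P' * B (L j) a m = P * B (L j') a' m" for m by (simp add: fun_eq_iff)
  have "P' * (a m * (G m - L j)) = P * (a' m * (G m - L j'))" for m
    using zG(2)[of m] eqB[of m] unfolding B by (simp add: field_simps)
  then have "a' m * (G m - L j') = (P' / P) * (a m * (G m - L j))" for m
    using P0 by (simp add: field_simps)
  then show ?thesis using P0 by (intro exI[of _ "P' / P"]) auto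
qed

end

section \<open>The dual transform\<close>

context cauchy_nodes
begin

lemma Hfun_zero [simp]: "Hfun G v (\<lambda>_. 0) z = 0"
  by (simp add: Hfun_def)

lemma Hfun_diff:
  assumes "a \<in> l2w v" "b \<in> l2w v" "z \<in> star_set G v"
  shows "Hfun G v (\<lambda>n. a n - b n) z = Hfun G v a z - Hfun G v b z"
  using Hfun_add_scale[OF assms, of "-1"] by simp

lemma Hfun_scale:
  assumes "a \<in> l2w v" "z \<in> star_set G v"
  shows "Hfun G v (\<lambda>n. c * a n) z = c * Hfun G v a z"
  using Hfun_add_scale[of "\<lambda>_. 0" a z c] assms by (simp add: l2w_def)

lemma Hfun_sum:
  assumes "finite I" "\<And>i. i \<in> I \<Longrightarrow> f i \<in> l2w v" "z \<in> star_set G v"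
  shows "Hfun G v (\<lambda>n. \<Sum>i\<in>I. c i * f i n) z = (\<Sum>i\<in>I. c i * Hfun G v (f i) z)"
  using assms(1,2)
proof (induction I rule: finite_induct)
  case (insert i I)
  have "(\<lambda>n. \<Sum>i\<in>I. c i * f i n) \<in> l2w v"
    using insert by (intro l2w_sum v_nonneg l2w_scale) auto
  from Hfun_add_scale[OF this _ assms(3), of "f i" "c i"] insert show ?case
    by (simp add: add.commute)
qed simp

lemma bessel_weight_pos: "0 < bessel_weight G v L j"
proof -
  have "0 < (\<Sum>n. v n / (cmod (L j - G n))\<^sup>2)"
    using L_in_star[of j] v_pos by (intro suminf_pos) (auto simp: star_set_def)
  then show ?thesis by (simp add: bessel_weight_def)
qed

text \<open>A vector witnessing exactness at \<open>k\<close> cannot vanish at \<open>L k\<close>,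
  by uniqueness, and so can be normalised there.\<close>

lemma ex_dual_vectors:
  assumes "exact_uniqueness_seq G v L"
  shows "\<exists>a\<in>l2w v. \<forall>i. Hfun G v a (L i) = (if i = k then 1 else 0)"
proof -
  obtain a where a: "a \<in> l2w v" "a \<noteq> (\<lambda>_. 0)" "\<And>j. j \<noteq> k \<Longrightarrow> Hfun G v a (L j) = 0"
    using assms unfolding exact_uniqueness_seq_def by blast
  have "Hfun G v a (L k) \<noteq> 0"
    using assms a unfolding exact_uniqueness_seq_def uniqueness_seq_def by metis
  then show ?thesis
    using a L_in_star
    by (intro bexI[of _ "\<lambda>n. inverse (Hfun G v a (L k)) * a n"]) (auto simp: Hfun_scale l2w_scale)
qed

lemma evec_eqI:
  assumes "uniqueness_seq G v L" "a \<in> l2w v" "\<And>i. Hfun G v a (L i) = (if i = 0 then 1 else 0)"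
  shows "evec G v L = a"
  unfolding evec_def
proof (rule the_equality)
  show "a \<in> l2w v \<and> Hfun G v a (L 0) = 1 \<and> (\<forall>j. j \<noteq> 0 \<longrightarrow> Hfun G v a (L j) = 0)"
    using assms by simp
next
  fix b assume b: "b \<in> l2w v \<and> Hfun G v b (L 0) = 1 \<and> (\<forall>j. j \<noteq> 0 \<longrightarrow> Hfun G v b (L j) = 0)"
  have "Hfun G v (\<lambda>n. b n - a n) (L i) = 0" for i
    using Hfun_diff[OF _ assms(2) L_in_star[of i], of b] b assms(3)[of i] by (cases "i = 0") auto
  moreover have "(\<lambda>n. b n - a n) \<in> l2w v" using b assms(2) by (intro l2w_diff v_nonneg) auto
  ultimately have "(\<lambda>n. b n - a n) = (\<lambda>_. 0)"
    using assms(1) unfolding uniqueness_seq_def by blast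
  then show "b = a" by (simp add: fun_eq_iff)
qed

end

text \<open>The weights are chosen to make two rescalings isometric: multiplication by
  \<open>\<omega> j * c j\<close> from \<open>l2w \<omega>\<close> to \<open>l2w w\<close>, and
  multiplication by \<open>e n * (G n - L 0)\<close> from \<open>l2w \<nu>\<close> to
  \<open>l2w v\<close>.\<close>

locale dual_system = cauchy_nodes G v L
  for G :: "nat \<Rightarrow> complex" and v :: "nat \<Rightarrow> real" and L :: "nat \<Rightarrow> complex" +
  fixes w \<omega> \<nu> :: "nat \<Rightarrow> real" and e c :: "nat \<Rightarrow> complex" and d :: "nat \<Rightarrow> nat \<Rightarrow> complex"
  assumes w_pos: "0 < w j"
    and d_l2w: "d j \<in> l2w v"
    and Hfun_d: "Hfun G v (d j) (L i) = (if i = j then 1 else 0)"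
    and c_nonzero [simp]: "c j \<noteq> 0"
    and dual_prop: "e n * (G n - L 0) = c j * (d j n * (G n - L j))"
    and \<omega>_eq: "\<omega> j = 1 / (w j * (cmod (c j))\<^sup>2)"
    and \<nu>_eq: "\<nu> n = v n * (cmod (L 0 - G n))\<^sup>2 * (cmod (e n))\<^sup>2"

lemma (in cauchy_nodes) ex_dual_system:
  assumes exact: "exact_uniqueness_seq G v L"
  shows "\<exists>c d. dual_system G v L (bessel_weight G v L) (varpi_weight G v L) (nu_weight G v L)
    (evec G v L) c d"
proof -
  have uniq: "uniqueness_seq G v L" using exact by (simp add: exact_uniqueness_seq_def)
  have Linj: "inj L" using uniq by (simp add: uniqueness_seq_def)
  obtain d where d: "\<And>j. d j \<in> l2w v" and Hd: "\<And>i j. Hfun G v (d j) (L i) = (if i = j then 1 else 0)"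
    using ex_dual_vectors[OF exact] by metis
  have e: "evec G v L = d 0" by (rule evec_eqI[OF uniq d Hd])
  have d0: "d j \<noteq> (\<lambda>_. 0)" for j
    using Hd[of j j] by auto
  have "\<exists>c. c \<noteq> 0 \<and> (\<forall>n. d 0 n * (G n - L 0) = c * (d j n * (G n - L j)))" for j
    by (rule dual_vectors_proportional[OF uniq d d0 _ d d0]) (simp_all add: Hd)
  then obtain c where c0: "\<And>j. c j \<noteq> 0"
    and c: "\<And>j n. d 0 n * (G n - L 0) = c j * (d j n * (G n - L j))" by metis
  have varpi: "varpi_weight G v L j = 1 / (bessel_weight G v L j * (cmod (c j))\<^sup>2)" for j
  proof (cases "j = 0")
    case True
    obtain n where "d 0 n \<noteq> 0" using d0[of 0] by (auto simp: fun_eq_iff)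
    \<comment> \<open>For \<open>j = 0\<close> the proportionality compares \<open>d 0\<close> with
      itself.\<close>
    then have "c 0 = 1" using c[of n 0] by auto
    then show ?thesis using True by (simp add: varpi_weight_def inverse_eq_divide)
  next
    case False
    then have LL: "L j - L 0 \<noteq> 0" using Linj by (auto simp: inj_eq)
    \<comment> \<open>Proportionality gives
      \<open>(c j * d j n - d 0 n) * (L j - G n) = - d 0 n * (L j - L 0)\<close>. This lowers the
      double pole to a simple one, so the series in \<open>varpi_weight\<close> becomes a value of
      \<open>Hfun\<close> at \<open>L j\<close>.\<close>
    let ?x = "\<lambda>n. (- 1 / (L j - L 0)) * (c j * d j n - d 0 n)"
    have "d 0 n * complex_of_real (v n) / (L j - G n)\<^sup>2 = ?x n * complex_of_real (v n) / (L j - G n)" for n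
    proof -
      have nz: "L j - G n \<noteq> 0" by simp
      have "(c j * d j n - d 0 n) * (L j - G n) = - (d 0 n * (L j - L 0))"
        using c[of n j] by (simp add: algebra_simps)
      then have "d 0 n = ?x n * (L j - G n)" using LL by (simp add: divide_simps)
      moreover have "x * q * r / q\<^sup>2 = x * r / q" if "q \<noteq> 0" for x q r :: complex
        using that by (simp add: power2_eq_square)
      ultimately show ?thesis using nz by (metis (no_types))
    qed
    then have "(\<Sum>n. d 0 n * complex_of_real (v n) / (L j - G n)\<^sup>2) = Hfun G v ?x (L j)"
      by (simp add: Hfun_def)
    also have "\<dots> = (- 1 / (L j - L 0)) * (c j * Hfun G v (d j) (L j) - Hfun G v (d 0) (L j))"
      by (simp only: Hfun_scale Hfun_diff l2w_scale l2w_diff[OF v_nonneg] d L_in_star)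
    also have "\<dots> = - c j / (L j - L 0)" using False by (simp add: Hd)
    finally have S: "(\<Sum>n. d 0 n * complex_of_real (v n) / (L j - G n)\<^sup>2) = - c j / (L j - L 0)" .
    show ?thesis
      using False LL c0[of j] bessel_weight_pos[of j] unfolding varpi_weight_def e S
      by (simp add: norm_divide power_divide field_simps)
  qed
  show ?thesis
    by (intro exI[of _ c] exI[of _ d], unfold_locales)
       (auto simp: bessel_weight_pos d Hd c0 c varpi nu_weight_def e)
qed

context dual_system
begin

section \<open>The rescaled dual transform as synthesis with the dual vectors\<close>

lemma w_nonneg: "\<forall>j. 0 \<le> w j"
  using w_pos by (simp add: less_imp_le)

lemma \<omega>_pos: "\<forall>j. 0 < \<omega> j"
  using w_pos by (simp add: \<omega>_eq)

lemma \<omega>_nonneg: "\<forall>j. 0 \<le> \<omega> j"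
  using \<omega>_pos by (simp add: less_imp_le)

lemma weighted_square_\<omega>: "(cmod (b j))\<^sup>2 * \<omega> j = (cmod (b j * \<omega> j * c j))\<^sup>2 * w j"
  using w_pos[of j] by (simp add: \<omega>_eq norm_mult norm_divide power_mult_distrib field_simps power2_eq_square)

lemma l2w_\<omega>_iff: "b \<in> l2w \<omega> \<longleftrightarrow> (\<lambda>j. b j * \<omega> j * c j) \<in> l2w w"
  by (simp only: l2w_def mem_Collect_eq weighted_square_\<omega>)

lemma l2norm_\<omega>: "l2norm \<omega> b = l2norm w (\<lambda>j. b j * \<omega> j * c j)"
  by (simp only: l2norm_def weighted_square_\<omega>)

lemma weighted_square_\<nu>: "(cmod (x n))\<^sup>2 * \<nu> n = (cmod (e n * (G n - L 0) * x n))\<^sup>2 * v n"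
  by (simp add: \<nu>_eq norm_mult power_mult_distrib norm_minus_commute)

lemma l2w_\<nu>_iff: "x \<in> l2w \<nu> \<longleftrightarrow> (\<lambda>n. e n * (G n - L 0) * x n) \<in> l2w v"
  by (simp only: l2w_def mem_Collect_eq weighted_square_\<nu>)

lemma l2norm_\<nu>: "l2norm \<nu> x = l2norm v (\<lambda>n. e n * (G n - L 0) * x n)"
  by (simp only: l2norm_def weighted_square_\<nu>)

text \<open>After both rescalings the Cauchy matrix of the dual transform has entries
  \<open>d j n\<close>. It thus becomes the synthesis map that sends \<open>\<beta>\<close> to the
  series of \<open>\<beta> j * d j\<close>, the natural candidate for the inverse.\<close>

lemma prop_term:
  fixes b :: "nat \<Rightarrow> complex"
  shows "e n * (G n - L 0) * (b j * \<omega> j / (G n - L j)) = b j * \<omega> j * c j * d j n"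
  by (simp add: dual_prop[of n j])

lemma finite_combination:
  shows "(\<lambda>n. \<Sum>j<N. \<beta> j * d j n) \<in> l2w v"
    "Hfun G v (\<lambda>n. \<Sum>j<N. \<beta> j * d j n) (L i) = truncate_seq N \<beta> i"
  using Hfun_sum[of "{..<N}" d "L i" \<beta>]
  by (auto intro!: l2w_sum v_nonneg l2w_scale d_l2w simp: L_in_star Hfun_d truncate_seq_def d_l2w
      sum.delta if_distrib cong: if_cong)

text \<open>On truncated data the rescaled transform is a finite combination of dual vectors and
  interpolates exactly. Its boundedness and the continuity of point evaluation carry this over to
  all data, with the same constant.\<close>

lemma bounded_right_inverse:
  assumes star: "range G \<subseteq> star_set L \<omega>" and T: "bounded_op \<omega> \<nu> (Hmap L \<omega> G)"
  shows "\<exists>C. \<forall>\<beta>\<in>l2w w. \<exists>a\<in>l2w v. Hmap G v L a = \<beta> \<and> l2norm v a \<le> C * l2norm w \<beta>"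
proof -
  interpret T: cauchy_nodes L \<omega> G by unfold_locales (use \<omega>_pos star in auto)
  obtain C where mem: "\<And>b. b \<in> l2w \<omega> \<Longrightarrow> Hmap L \<omega> G b \<in> l2w \<nu>"
    and C: "\<And>b. b \<in> l2w \<omega> \<Longrightarrow> l2norm \<nu> (Hmap L \<omega> G b) \<le> C * l2norm \<omega> b"
    using T unfolding bounded_op_def by auto
  define S where "S = (\<lambda>b n. e n * (G n - L 0) * Hmap L \<omega> G b n)"
  have S: "S b \<in> l2w v" "l2norm v (S b) \<le> C * l2norm \<omega> b" if "b \<in> l2w \<omega>" for b
    using mem[OF that] C[OF that] unfolding S_def l2w_\<nu>_iff l2norm_\<nu> by auto
  have "\<exists>a\<in>l2w v. Hmap G v L a = \<beta> \<and> l2norm v a \<le> C * l2norm w \<beta>" if \<beta>: "\<beta> \<in> l2w w" for \<beta>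
  proof -
    \<comment> \<open>Undoes the isometric rescaling, so that the norm of \<open>b\<close> is that
      of \<open>\<beta>\<close>.\<close>
    define b where "b = (\<lambda>j. \<beta> j / (\<omega> j * c j))"
    have b\<beta>: "b j * \<omega> j * c j = \<beta> j" for j using \<omega>_pos by (simp add: b_def less_imp_neq[symmetric])
    have b: "b \<in> l2w \<omega>" using \<beta> unfolding l2w_\<omega>_iff b\<beta> .
    have "Hfun G v (S b) (L i) = \<beta> i" for i
    proof -
      have fin: "S (truncate_seq N b) = (\<lambda>n. \<Sum>j<N. \<beta> j * d j n)" for N
      proof
        fix n
        have "Hmap L \<omega> G (truncate_seq N b) n = (\<Sum>j<N. b j * \<omega> j / (G n - L j))"
          unfolding Hmap_def Hfun_def
          by (subst suminf_finite[of "{..<N}"]) (auto simp: truncate_seq_def)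
        then show "S (truncate_seq N b) n = (\<Sum>j<N. \<beta> j * d j n)"
          unfolding S_def by (simp only: sum_distrib_left prop_term[where n=n and b=b] b\<beta>)
      qed
      have diff: "S (\<lambda>j. b j - truncate_seq N b j) = (\<lambda>n. S b n - S (truncate_seq N b) n)" for N
        unfolding S_def Hmap_def using T.Hfun_diff[OF b truncate_seq_l2w T.L_in_star]
        by (simp add: right_diff_distrib)
      have bN: "(\<lambda>j. b j - truncate_seq N b j) \<in> l2w \<omega>" for N
        by (intro l2w_diff \<omega>_nonneg b) simp
      let ?K = "l2norm v (cauchy_kernel G (L i))"
      \<comment> \<open>For \<open>N > i\<close> the truncation retains the entry
        \<open>\<beta> i\<close>.\<close>
      have bound: "cmod (Hfun G v (S b) (L i) - \<beta> i)
         \<le> C * l2norm \<omega> (\<lambda>j. b j - truncate_seq N b j) * ?K" if "N > i" for N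
      proof -
        have "Hfun G v (S b) (L i) - \<beta> i = Hfun G v (S (\<lambda>j. b j - truncate_seq N b j)) (L i)"
          unfolding diff fin using finite_combination[where N=N and \<beta>=\<beta>] that
          by (simp add: Hfun_diff[OF S(1)[OF b] finite_combination(1) L_in_star] truncate_seq_def)
        also have "cmod \<dots> \<le> l2norm v (S (\<lambda>j. b j - truncate_seq N b j)) * ?K"
          by (intro Hfun_bound S(1) bN L_in_star)
        also have "\<dots> \<le> C * l2norm \<omega> (\<lambda>j. b j - truncate_seq N b j) * ?K"
          by (intro mult_right_mono S(2) bN l2norm_nonneg v_nonneg cauchy_kernel_l2w L_in_star)
        finally show ?thesis .
      qed
      have lim: "(\<lambda>N. C * l2norm \<omega> (\<lambda>j. b j - truncate_seq N b j) * ?K) \<longlonglongrightarrow> 0"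
        by (intro tendsto_mult_left_zero tendsto_mult_right_zero truncate_seq_tendsto \<omega>_nonneg b)
      have "cmod (Hfun G v (S b) (L i) - \<beta> i) \<le> 0"
        by (rule tendsto_lowerbound[OF lim])
           (use bound in \<open>auto intro: eventually_mono[OF eventually_gt_at_top[of i]]\<close>)
      then show ?thesis by simp
    qed
    then have "Hmap G v L (S b) = \<beta>" by (simp add: Hmap_def)
    then show ?thesis using S[OF b] unfolding l2norm_\<omega> b\<beta> by blast
  qed
  then show ?thesis by blast
qed

text \<open>The bounded inverse makes every vector a coordinatewise convergent series of dual
  vectors. Read through the rescalings, this series is the dual transform, and the norm of the
  inverse bounds it.\<close>

lemma bounded_dual_transform:
  assumes inv: "invertible_op v w (Hmap G v L)"
  shows "range G \<subseteq> star_set L \<omega>" "bounded_op \<omega> \<nu> (Hmap L \<omega> G)"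
proof -
  have bij: "bij_betw (Hmap G v L) (l2w v) (l2w w)"
    and fwd: "\<And>a. a \<in> l2w v \<Longrightarrow> Hmap G v L a \<in> l2w w"
    using inv by (auto simp: invertible_op_def bounded_op_def)
  obtain C' where C': "\<And>x. x \<in> l2w w \<Longrightarrow> l2norm v (the_inv_into (l2w v) (Hmap G v L) x) \<le> C' * l2norm w x"
    using inv unfolding invertible_op_def bounded_op_def by blast
  \<comment> \<open>The absolute value provides a nonnegative constant.\<close>
  define C where "C = \<bar>C'\<bar>"
  have C: "l2norm v a \<le> C * l2norm w (Hmap G v L a)" if a: "a \<in> l2w v" for a
  proof -
    have "l2norm v a \<le> C' * l2norm w (Hmap G v L a)"
      using C'[OF fwd[OF a]] a bij by (simp add: the_inv_into_f_f bij_betw_def)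
    also have "\<dots> \<le> C * l2norm w (Hmap G v L a)"
      unfolding C_def by (intro mult_right_mono l2norm_nonneg w_nonneg fwd a) auto
    finally show ?thesis .
  qed
  have repr: "(\<lambda>j. Hmap G v L a j * d j n) sums a n" if a: "a \<in> l2w v" for a n
  proof -
    let ?\<beta> = "Hmap G v L a"
    let ?aN = "\<lambda>N n. \<Sum>j<N. ?\<beta> j * d j n"
    have sv: "0 < sqrt (v n)" using v_pos by simp
    have le: "cmod (a n - ?aN N n) \<le> C / sqrt (v n) * l2norm w (\<lambda>j. ?\<beta> j - truncate_seq N ?\<beta> j)" for N
    proof -
      have D: "(\<lambda>n. a n - ?aN N n) \<in> l2w v" by (intro l2w_diff v_nonneg a finite_combination)
      have H: "Hmap G v L (\<lambda>n. a n - ?aN N n) = (\<lambda>j. ?\<beta> j - truncate_seq N ?\<beta> j)"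
      proof
        fix i
        show "Hmap G v L (\<lambda>n. a n - ?aN N n) i = ?\<beta> i - truncate_seq N ?\<beta> i"
          using Hfun_diff[OF a finite_combination(1)[where N=N and \<beta>="?\<beta>"] L_in_star[of i]]
          unfolding finite_combination(2) by (simp only: Hmap_def)
      qed
      have "cmod (a n - ?aN N n) * sqrt (v n) \<le> C * l2norm w (\<lambda>j. ?\<beta> j - truncate_seq N ?\<beta> j)"
        using order_trans[OF l2w_coord[OF v_nonneg D, of n] C[OF D]] unfolding H .
      then show ?thesis using sv by (simp add: pos_le_divide_eq)
    qed
    have lim: "(\<lambda>N. C / sqrt (v n) * l2norm w (\<lambda>j. ?\<beta> j - truncate_seq N ?\<beta> j)) \<longlonglongrightarrow> 0"
      by (rule tendsto_mult_right_zero[OF truncate_seq_tendsto[OF w_nonneg fwd[OF a]]])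
    have "(\<lambda>N. a n - ?aN N n) \<longlonglongrightarrow> 0"
      by (rule Lim_null_comparison[OF always_eventually[OF allI] lim]) (rule le)
    from tendsto_diff[OF tendsto_const this, of "a n"] show ?thesis
      by (simp add: sums_def)
  qed
  \<comment> \<open>Otherwise the \<open>n\<close>-th coordinates of all dual vectors vanish, and
    \<open>unit_seq n\<close> has no expansion.\<close>
  have e0: "e n \<noteq> 0" for n
  proof
    assume "e n = 0"
    then have "d j n = 0" for j using dual_prop[of n j] by simp
    then have "(\<lambda>j. 0) sums unit_seq n n" using repr[OF unit_seq_l2w, of n n] by simp
    then show False by (simp add: unit_seq_def sums_iff)
  qed
  have row: "summable (\<lambda>j. (cmod (d j n))\<^sup>2 / w j)" for n
  proof (rule summableI_nonneg_bounded)
    fix N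
    define X where "X = (\<Sum>j<N. (cmod (d j n))\<^sup>2 / w j)"
    have X0: "0 \<le> X" unfolding X_def using w_nonneg by (intro sum_nonneg) auto
    \<comment> \<open>The extremal vector for the functional given by the \<open>n\<close>-th
      coordinates of the dual vectors: its truncation has squared norm \<open>X\<close>, and the
      functional takes the value \<open>X\<close> on it. The bound on the functional therefore
      bounds \<open>X\<close>.\<close>
    define \<beta> where "\<beta> = (\<lambda>j. cnj (d j n) / complex_of_real (w j))"
    have "(\<Sum>j<N. \<beta> j * d j n) = complex_of_real X"
      by (simp add: X_def \<beta>_def complex_norm_square mult.commute flip: of_real_power)
    moreover have "l2norm w (truncate_seq N \<beta>) = sqrt X"
    proof -
      have "(\<Sum>j. (cmod (truncate_seq N \<beta> j))\<^sup>2 * w j) = (\<Sum>j<N. (cmod (truncate_seq N \<beta> j))\<^sup>2 * w j)"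
        by (rule suminf_finite) (auto simp: truncate_seq_def)
      also have "\<dots> = X"
        unfolding X_def \<beta>_def using w_pos
        by (intro sum.cong) (auto simp: truncate_seq_def norm_divide power_divide power2_eq_square less_imp_neq[symmetric])
      finally show ?thesis by (simp add: l2norm_def)
    qed
    moreover have "cmod (\<Sum>j<N. \<beta> j * d j n) * sqrt (v n) \<le> C * l2norm w (truncate_seq N \<beta>)"
      using l2w_coord[OF v_nonneg finite_combination(1)[where N=N and \<beta>=\<beta>], of n]
        C[OF finite_combination(1)[where N=N and \<beta>=\<beta>]]
      unfolding Hmap_def finite_combination(2) by linarith
    ultimately have le: "X * sqrt (v n) \<le> C * sqrt X" using X0 by simp
    have "sqrt X * sqrt (v n) \<le> C"
    proof (cases "X = 0")
      case True then show ?thesis by (simp add: C_def)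
    next
      case False
      then have "0 < sqrt X" using X0 by simp
      moreover have "sqrt X * (sqrt X * sqrt (v n)) \<le> sqrt X * C"
        using le X0 by (simp add: mult.assoc[symmetric] mult.commute)
      ultimately show ?thesis by (simp only: mult_le_cancel_left_pos)
    qed
    then have "(sqrt X * sqrt (v n))\<^sup>2 \<le> C\<^sup>2" using X0 v_nonneg by (intro power_mono) auto
    then have "X * v n \<le> C\<^sup>2" using X0 v_nonneg by (simp add: power_mult_distrib)
    then show "(\<Sum>j<N. (cmod (d j n))\<^sup>2 / w j) \<le> C\<^sup>2 / v n"
      using v_pos by (simp add: X_def[symmetric] field_simps)
  qed (use w_nonneg in auto)
  show star: "range G \<subseteq> star_set L \<omega>"
  proof -
    \<comment> \<open>By proportionality, the series deciding whether \<open>G n\<close> lies in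
      \<open>star_set L \<omega>\<close> is a constant multiple of the one in \<open>row\<close>;
      the constant is finite because \<open>e n\<close> is nonzero.\<close>
    have "\<omega> j / (cmod (G n - L j))\<^sup>2
        = inverse ((cmod (e n * (G n - L 0)))\<^sup>2) * ((cmod (d j n))\<^sup>2 / w j)" for n j
    proof -
      have "(cmod (e n * (G n - L 0)))\<^sup>2 = (cmod (c j))\<^sup>2 * ((cmod (d j n))\<^sup>2 * (cmod (G n - L j))\<^sup>2)"
        by (simp add: dual_prop[of n j] norm_mult power_mult_distrib)
      moreover have "d j n \<noteq> 0" using dual_prop[of n j] e0[of n] by auto
      ultimately show ?thesis using w_pos[of j] by (simp add: \<omega>_eq field_simps)
    qed
    then have "summable (\<lambda>j. \<omega> j / (cmod (G n - L j))\<^sup>2)" for n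
      using summable_mult[OF row[of n], of "inverse ((cmod (e n * (G n - L 0)))\<^sup>2)"] by simp
    moreover have "G n \<notin> range L" for n by auto
    ultimately show ?thesis by (auto simp: star_set_def)
  qed
  have "Hmap L \<omega> G b \<in> l2w \<nu> \<and> l2norm \<nu> (Hmap L \<omega> G b) \<le> C * l2norm \<omega> b" if b: "b \<in> l2w \<omega>" for b
  proof -
    have "(\<lambda>j. b j * \<omega> j * c j) \<in> l2w w" using b by (simp only: l2w_\<omega>_iff)
    then have "(\<lambda>j. b j * \<omega> j * c j) \<in> Hmap G v L ` l2w v" using bij by (simp add: bij_betw_def)
    then obtain a where a: "a \<in> l2w v" and Ha: "Hmap G v L a = (\<lambda>j. b j * \<omega> j * c j)" by auto
    have "e n * (G n - L 0) * Hmap L \<omega> G b n = a n" for n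
    proof -
      let ?K = "e n * (G n - L 0)"
      have K: "?K \<noteq> 0" using e0 by simp
      have "(\<lambda>j. ?K * (b j * \<omega> j / (G n - L j))) sums a n"
        using repr[OF a, of n] unfolding Ha prop_term[where n=n and b=b] .
      then have "(\<lambda>j. b j * \<omega> j / (G n - L j)) sums (a n / ?K)"
        by (rule sums_mult_D[OF _ K])
      then show ?thesis using K by (simp add: Hmap_def Hfun_def sums_iff)
    qed
    then show ?thesis
      using a C[OF a] unfolding l2w_\<nu>_iff l2norm_\<nu> l2norm_\<omega> Ha by simp
  qed
  then show "bounded_op \<omega> \<nu> (Hmap L \<omega> G)" unfolding bounded_op_def by blast
qed

end

section \<open>From bijectivity and right inverses to the equivalence\<close>

lemma (in cauchy_nodes) invertible_imp_exact_uniqueness_seq: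
  assumes inv: "invertible_op v w (Hmap G v L)" and L_inj: "inj L"
  shows "exact_uniqueness_seq G v L"
proof -
  have bij: "bij_betw (Hmap G v L) (l2w v) (l2w w)"
    using inv by (simp add: invertible_op_def)
  have zero: "(\<lambda>_. 0) \<in> l2w v" "Hmap G v L (\<lambda>_. 0) = (\<lambda>_. 0)"
    by (simp_all add: l2w_def Hmap_def)
  have "a = (\<lambda>_. 0)" if a: "a \<in> l2w v" "\<forall>j. Hfun G v a (L j) = 0" for a
  proof (rule inj_onD[OF bij_betw_imp_inj_on[OF bij] _ a(1) zero(1)])
    show "Hmap G v L a = Hmap G v L (\<lambda>_. 0)" using a(2) by (simp add: Hmap_def)
  qed
  moreover have "\<exists>a\<in>l2w v. a \<noteq> (\<lambda>_. 0) \<and> (\<forall>j. j \<noteq> k \<longrightarrow> Hfun G v a (L j) = 0)" for k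
  proof -
    \<comment> \<open>The preimage of a unit sequence vanishes at all points except
      \<open>L k\<close>, which witnesses exactness.\<close>
    have "unit_seq k \<in> Hmap G v L ` l2w v" using bij by (simp add: bij_betw_def)
    then obtain a where a: "a \<in> l2w v" and "Hmap G v L a = unit_seq k" by auto
    then have Ha: "Hfun G v a (L j) = unit_seq k j" for j by (metis Hmap_def)
    have "a \<noteq> (\<lambda>_. 0)" using Ha[of k] by (auto simp: unit_seq_def)
    with a Ha show ?thesis by (auto simp: unit_seq_def)
  qed
  ultimately show ?thesis
    using L_inj L_star unfolding exact_uniqueness_seq_def uniqueness_seq_def by blast
qed

text \<open>Uniqueness supplies injectivity, so the bounded solutions provided by the last
  assumption are the values of the inverse.\<close>

lemma (in cauchy_nodes) invertible_opI:
  assumes uniq: "uniqueness_seq G v L" and bdd: "bounded_op v w (Hmap G v L)"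
    and C: "\<And>\<beta>. \<beta> \<in> l2w w \<Longrightarrow> \<exists>a\<in>l2w v. Hmap G v L a = \<beta> \<and> l2norm v a \<le> C * l2norm w \<beta>"
  shows "invertible_op v w (Hmap G v L)"
proof -
  have inj: "inj_on (Hmap G v L) (l2w v)"
  proof (rule inj_onI)
    fix a b assume ab: "a \<in> l2w v" "b \<in> l2w v" and eq: "Hmap G v L a = Hmap G v L b"
    have "Hfun G v (\<lambda>n. a n - b n) (L j) = 0" for j
      using fun_cong[OF eq, of j] by (simp add: Hfun_diff[OF ab L_in_star] Hmap_def)
    then have "(\<lambda>n. a n - b n) = (\<lambda>_. 0)"
      using uniq l2w_diff[OF v_nonneg ab] unfolding uniqueness_seq_def by blast
    then show "a = b" by (simp add: fun_eq_iff)
  qed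
  have "Hmap G v L ` l2w v \<subseteq> l2w w" using bdd by (auto simp: bounded_op_def)
  moreover have "l2w w \<subseteq> Hmap G v L ` l2w v" using C by blast
  ultimately have "bij_betw (Hmap G v L) (l2w v) (l2w w)"
    using inj by (auto simp: bij_betw_def)
  moreover have "the_inv_into (l2w v) (Hmap G v L) \<beta> \<in> l2w v \<and>
      l2norm v (the_inv_into (l2w v) (Hmap G v L) \<beta>) \<le> C * l2norm w \<beta>" if "\<beta> \<in> l2w w" for \<beta>
    using C[OF that] the_inv_into_f_f[OF inj] by auto
  then have "bounded_op w v (the_inv_into (l2w v) (Hmap G v L))"
    unfolding bounded_op_def by blast
  ultimately show ?thesis using bdd by (simp add: invertible_op_def)
qed

theorem theorem3:
  fixes G :: "nat \<Rightarrow> complex" and v :: "nat \<Rightarrow> real" and L :: "nat \<Rightarrow> complex"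
  assumes G_inj: "inj G"
    and v_pos: "\<And>n. v n > 0"
    and star_ne: "star_set G v \<noteq> {}"
    and gen: "\<And>M. exact_uniqueness_seq G v M \<Longrightarrow> \<exists>F. generating_function G v M F"
    and L_inj: "inj L"
    and L_star: "range L \<subseteq> star_set G v"
    and bdd: "bounded_op v (bessel_weight G v L) (Hmap G v L)"
  shows "invertible_op v (bessel_weight G v L) (Hmap G v L) \<longleftrightarrow>
    (exact_uniqueness_seq G v L \<and>
     range G \<subseteq> star_set L (varpi_weight G v L) \<and>
     bounded_op (varpi_weight G v L) (nu_weight G v L) (Hmap L (varpi_weight G v L) G))"
proof -
  interpret cauchy_nodes G v L by unfold_locales (use v_pos L_star in auto)
  show ?thesis
  proof
    assume inv: "invertible_op v (bessel_weight G v L) (Hmap G v L)"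
    have exact: "exact_uniqueness_seq G v L"
      by (rule invertible_imp_exact_uniqueness_seq[OF inv L_inj])
    then obtain c d where "dual_system G v L (bessel_weight G v L) (varpi_weight G v L) (nu_weight G v L)
        (evec G v L) c d"
      using ex_dual_system by blast
    from dual_system.bounded_dual_transform[OF this inv] exact
    show "exact_uniqueness_seq G v L \<and> range G \<subseteq> star_set L (varpi_weight G v L) \<and>
      bounded_op (varpi_weight G v L) (nu_weight G v L) (Hmap L (varpi_weight G v L) G)" by blast
  next
    assume rhs: "exact_uniqueness_seq G v L \<and> range G \<subseteq> star_set L (varpi_weight G v L) \<and>
      bounded_op (varpi_weight G v L) (nu_weight G v L) (Hmap L (varpi_weight G v L) G)"
    then obtain c d where "dual_system G v L (bessel_weight G v L) (varpi_weight G v L) (nu_weight G v L)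
        (evec G v L) c d"
      using ex_dual_system by blast
    from dual_system.bounded_right_inverse[OF this] rhs obtain C where
      "\<And>\<beta>. \<beta> \<in> l2w (bessel_weight G v L) \<Longrightarrow>
        \<exists>a\<in>l2w v. Hmap G v L a = \<beta> \<and> l2norm v a \<le> C * l2norm (bessel_weight G v L) \<beta>"
      by blast
    moreover have "uniqueness_seq G v L" using rhs by (simp add: exact_uniqueness_seq_def)
    ultimately show "invertible_op v (bessel_weight G v L) (Hmap G v L)"
      by (intro invertible_opI bdd)
  qed
qed

end
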